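(* Let $k\ge 2$ and $n>k$ be integers and let $\alpha>0$ be real. Consider the $k$th price auction with $n$ bidders whose valuations $X_1,\dots,X_n$ are i.i.d. on $[0,1]$ with distribution function $F(x)=x^\alpha$. Then there is a unique symmetric equilibrium. The equilibrium common strategy $\beta:[0,1]\to\mathbb{R}^+$ is $$\beta(x)=\frac{\Gamma(n-k+1)\,\Gamma(n-1+1/\alpha)}{\Gamma(n-1)\,\Gamma(n-k+1+1/\alpha)}\,x ,$$ where $\Gamma$ is the Gamma function. In particular, if $\alpha=\frac1m$ where $m$ is a positive integer, then $$\beta(x)=\frac{(n-k+m+1)\cdots(n-2+m)}{(n-k+1)\cdots(n-2)}\,x .$$
   Context: $k$th price auction: $n$ bidders have independent valuations $X_1,\dots,X_n$ with common distribution function $F$; bidder $i$ observes only $X_i$ and submits a bid. The highest bidder wins and pays the $k$th highest of the $n$ bids; a winner with valuation $x$ paying price $p$ gets payoff $x-p$, and all other bidders get $0$. A strategy is a function from $[0,1]$ to $\mathbb{R}^+=[0,\infty)$ giving the bid for each valuation. A strategy profile is symmetric if all bidders use one common strategy $\beta$; it is an equilibrium (Bayesian Nash) if, when all other bidders bid according to $\beta$, a bidder with valuation $x$ maximizes expected payoff by bidding $\beta(x)$. Both products in the last formula have $k-2$ consecutive factors (empty products, equal to $1$, if $k=2$).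
   Formalization: Uniqueness is stated for valuations in [0,1) only, since raising the equilibrium bid at x=1 (a probability-zero valuation) gives another equilibrium; strategies are taken Borel measurable so that expected payoffs exist, and ties for the highest bid are broken uniformly at random. *)

theory Defs
  imports "HOL-Probability.Probability"
begin

text \<open>
  Bidders are the indices \<open>0, \<dots>, n - 1\<close>; a bid profile is a function \<open>b :: nat \<Rightarrow> real\<close>, of which
  only the values at indices below \<open>n\<close> matter.
\<close>

text \<open>The \<open>k\<close>th highest of the \<open>n\<close> bids, counted with multiplicity (\<open>k = 1\<close> is the maximum).\<close>

definition kth_highest_bid :: "nat \<Rightarrow> nat \<Rightarrow> (nat \<Rightarrow> real) \<Rightarrow> real" where
  "kth_highest_bid n k b = rev (sort (map b [0..<n])) ! (k - 1)"

definition highest_bidders :: "nat \<Rightarrow> (nat \<Rightarrow> real) \<Rightarrow> nat set" where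
  "highest_bidders n b = {i \<in> {..<n}. \<forall>j<n. b j \<le> b i}"

text \<open>
  Ties for the highest bid are broken uniformly at random, and the payoff below is averaged over
  this tie-breaking.  Without ties it is \<open>x - p\<close> for the winner and \<open>0\<close> for everybody else.
\<close>

definition auction_payoff :: "nat \<Rightarrow> nat \<Rightarrow> nat \<Rightarrow> real \<Rightarrow> (nat \<Rightarrow> real) \<Rightarrow> real" where
  "auction_payoff n k i x b =
     (if i \<in> highest_bidders n b
      then (x - kth_highest_bid n k b) / real (card (highest_bidders n b))
      else 0)"

text \<open>
  Expected payoff of bidder \<open>i\<close> with valuation \<open>x\<close> who bids \<open>a\<close> while every other bidder \<open>j\<close> bids
  \<open>\<beta> (X j)\<close>.  By independence of the valuations, conditioning on \<open>X i = x\<close> does not change the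
  law of the opponents' bids, so the expectation is unconditional.
\<close>

definition expected_payoff ::
    "'w measure \<Rightarrow> (nat \<Rightarrow> 'w \<Rightarrow> real) \<Rightarrow> nat \<Rightarrow> nat \<Rightarrow> (real \<Rightarrow> real) \<Rightarrow> nat \<Rightarrow> real \<Rightarrow> real \<Rightarrow> real" where
  "expected_payoff M X n k \<beta> i x a =
     (\<integral>\<omega>. auction_payoff n k i x (\<lambda>j. if j = i then a else \<beta> (X j \<omega>)) \<partial>M)"

text \<open>
  Strategies are functions from \<open>[0,1]\<close> to \<open>[0,\<infinity>)\<close>; Borel measurability is what makes expected
  payoffs meaningful (the payoff then lies between \<open>x - a\<close> or \<open>0\<close> and \<open>x\<close>, hence is integrable).
  Values of \<open>\<beta>\<close> outside \<open>[0,1]\<close> are irrelevant.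
\<close>

definition bidding_strategy :: "(real \<Rightarrow> real) \<Rightarrow> bool" where
  "bidding_strategy \<beta> \<longleftrightarrow>
     (\<forall>x\<in>{0..1}. 0 \<le> \<beta> x) \<and> \<beta> \<in> borel_measurable (restrict_space borel {0..1})"

text \<open>
  The valuation \<open>x = 1\<close> is special: if \<open>\<beta>\<close> is increasing, then a bidder of that type already wins
  almost surely by bidding \<open>\<beta> 1\<close>, and every higher bid yields the same payoff.  As the type has
  probability \<open>0\<close>, raising \<open>\<beta> 1\<close> turns an equilibrium into another one, so equilibria can be
  unique only on \<open>[0,1)\<close>.
\<close>

definition symmetric_equilibrium ::
    "'w measure \<Rightarrow> (nat \<Rightarrow> 'w \<Rightarrow> real) \<Rightarrow> nat \<Rightarrow> nat \<Rightarrow> (real \<Rightarrow> real) \<Rightarrow> bool" where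
  "symmetric_equilibrium M X n k \<beta> \<longleftrightarrow>
     bidding_strategy \<beta> \<and>
     (\<forall>i<n. \<forall>x\<in>{0..1}. \<forall>a\<ge>0.
        expected_payoff M X n k \<beta> i x a \<le> expected_payoff M X n k \<beta> i x (\<beta> x))"

end

theory Submission
  imports Defs
begin

text \<open>
  Against opponents whose bids have distribution function \<open>G\<close>, the payoff of type \<open>x\<close> depends on its bid
  only through the quantile \<open>w\<close> of the bid: it is \<open>x w^(n-1) - K w\<close>, where \<open>K\<close> is the expected payment.
  Its derivative in \<open>w\<close> is proportional to \<open>x - m w\<close>, where the expected price \<open>m w\<close> given that the best
  opponent bids at quantile \<open>w\<close> is nondecreasing. Incentive compatibility makes bids monotone in types
  up to null sets. An atom on quantiles \<open>[q, r]\<close> is impossible: types just below \<open>q\<close> force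
  \<open>m q \<ge> x\<^sub>q\<close>, where \<open>x\<^sub>q\<close> is the type at quantile \<open>q\<close>, the types in the atom force \<open>m\<close> to exceed \<open>x\<^sub>q\<close>
  somewhere in \<open>[q, r]\<close>, and then types just above \<open>q\<close> prefer to bid just below the atom. Without atoms
  incentive compatibility says \<open>m w = w^(1/\<alpha>)\<close>, an iterated integral equation for the quantile function of
  the bids. Differentiating it \<open>k - 2\<close> times gives the linear bids, and integrating back shows, by
  quasi-concavity of the payoff, that these are an equilibrium.
\<close>

text \<open>A strategy is only assumed measurable, so its bid distribution may have atoms and gaps,
  and no first-order condition in the bid itself is available. In the quantile \<open>w\<close>
  regularity is automatic: differentiating a binomial tail in \<open>w\<close> lowers both of its
  indices by one, and by Fubini \<open>tail_price\<close> inherits this in integrated form for every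
  monotone nonnegative \<open>G\<close>. One such step gives the marginal payoff and leaves the
  indices \<open>n - 2\<close> and \<open>k - 2\<close>; \<open>k - 2\<close> further steps leave
  \<open>n - k\<close> and \<open>0\<close>, where the price is \<open>w ^ (n - k)\<close> times the
  quantile function of the bids. With \<open>s = 1 / \<alpha>\<close>, a step down from
  \<open>Suc N\<close> multiplies the coefficient of the power of \<open>w\<close> by
  \<open>(Suc N + s) / Suc N\<close>; the product of these factors is the slope of the bids, hence
  the Gamma quotient.\<close>

section \<open>Fubini for integrals over compact intervals\<close>

lemma finite_measure_restrict_Icc:
  "finite_measure (restrict_space lborel {a..b::real})"
  by (rule finite_measureI)
     (use emeasure_lborel_Icc_eq[of a b] in \<open>auto simp: emeasure_restrict_space\<close>)

lemma
  fixes f :: "real \<Rightarrow> real"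
  assumes f: "f \<in> borel_measurable borel" and B: "\<And>x. x \<in> {a..b} \<Longrightarrow> \<bar>f x\<bar> \<le> B"
  shows bounded_borel_integrable_on_Icc: "f integrable_on {a..b}"
    and integral_Icc_eq_restrict_lborel: "integral {a..b} f = (\<integral>x. f x \<partial>restrict_space lborel {a..b})"
proof -
  interpret finite_measure "restrict_space lborel {a..b}"
    by (rule finite_measure_restrict_Icc)
  have "integrable (restrict_space lborel {a..b}) f"
    by (rule integrable_const_bound[of _ B])
       (use f B in \<open>auto simp: AE_restrict_space_iff intro: measurable_restrict_space1\<close>)
  then have s: "set_integrable lborel {a..b} f"
    by (subst (asm) integrable_restrict_space) (auto simp: set_integrable_def)
  show "f integrable_on {a..b}" "integral {a..b} f = (\<integral>x. f x \<partial>restrict_space lborel {a..b})"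
    using set_borel_integral_eq_integral[OF s]
    by (auto simp: integral_restrict_space set_lebesgue_integral_def)
qed

text \<open>Bridges the two integrals in use: expectations are Bochner integrals, while integrals
  over bids and quantiles are gauge integrals, which suit the calculus below. Fubini is applied to
  the finite measure \<open>restrict_space lborel {a..b}\<close>.\<close>

lemma integral_swap_Icc:
  fixes f :: "'a \<Rightarrow> real \<Rightarrow> real"
  assumes M: "finite_measure M"
    and f: "case_prod f \<in> borel_measurable (M \<Otimes>\<^sub>M borel)"
    and B: "\<And>\<omega> z. \<omega> \<in> space M \<Longrightarrow> z \<in> {a..b} \<Longrightarrow> \<bar>f \<omega> z\<bar> \<le> B"
  shows "(\<integral>\<omega>. integral {a..b} (f \<omega>) \<partial>M) = integral {a..b} (\<lambda>z. \<integral>\<omega>. f \<omega> z \<partial>M)"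
proof -
  let ?L = "restrict_space lborel {a..b}"
  interpret M: finite_measure M by fact
  interpret L: finite_measure ?L by (rule finite_measure_restrict_Icc)
  interpret pair_sigma_finite M ?L ..
  interpret P: finite_measure "M \<Otimes>\<^sub>M ?L"
    by (intro finite_measure_pair_measure M L.finite_measure_axioms)
  have m: "case_prod f \<in> borel_measurable (M \<Otimes>\<^sub>M ?L)"
  proof -
    have "(\<lambda>x. x) \<in> measurable (M \<Otimes>\<^sub>M ?L) (M \<Otimes>\<^sub>M borel)"
      by (auto intro!: measurable_Pair2' measurable_restrict_space1 simp: measurable_pair_iff comp_def
          intro: measurable_compose[OF measurable_snd])
    from measurable_compose[OF this f] show ?thesis by simp
  qed
  have int: "integrable (M \<Otimes>\<^sub>M ?L) (case_prod f)"
    by (rule P.integrable_const_bound[of _ B, OF AE_I2 m])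
       (use B in \<open>auto simp: space_pair_measure\<close>)
  have "(\<integral>\<omega>. integral {a..b} (f \<omega>) \<partial>M) = (\<integral>\<omega>. \<integral>z. f \<omega> z \<partial>?L \<partial>M)"
    by (intro Bochner_Integration.integral_cong refl integral_Icc_eq_restrict_lborel[of _ _ _ B])
       (use B f in \<open>auto\<close>)
  also have "\<dots> = (\<integral>z. \<integral>\<omega>. f \<omega> z \<partial>M \<partial>?L)"
    by (rule Fubini_integral[OF int, symmetric])
  also have "\<dots> = integral {a..b} (\<lambda>z. \<integral>\<omega>. f \<omega> z \<partial>M)"
  proof (rule integral_Icc_eq_restrict_lborel[symmetric])
    have "(\<lambda>(z,\<omega>). f \<omega> z) \<in> borel_measurable (borel \<Otimes>\<^sub>M M)"
      using measurable_compose[OF measurable_pair_swap' f] by (simp add: case_prod_beta)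
    then show "(\<lambda>z. \<integral>\<omega>. f \<omega> z \<partial>M) \<in> borel_measurable borel"
      by (rule M.borel_measurable_lebesgue_integral)
    fix z assume z: "z \<in> {a..b}"
    have fz: "(\<lambda>\<omega>. f \<omega> z) \<in> borel_measurable M"
      using measurable_compose[OF measurable_Pair2' f] z by simp
    have "\<bar>\<integral>\<omega>. f \<omega> z \<partial>M\<bar> \<le> (\<integral>\<omega>. \<bar>f \<omega> z\<bar> \<partial>M)" by (rule integral_abs_bound)
    also have "\<dots> \<le> (\<integral>\<omega>. B \<partial>M)"
      by (rule integral_mono) (use B z fz in \<open>auto intro!: M.integrable_const_bound[of _ B]\<close>)
    finally show "\<bar>\<integral>\<omega>. f \<omega> z \<partial>M\<bar> \<le> measure M (space M) * B" by simp
  qed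
  finally show ?thesis .
qed

subsection \<open>Binomial tails and truncated expected prices\<close>

text \<open>For \<open>N\<close> independent bids and a level of quantile \<open>v\<close>, this is
  the probability that all bids lie below the \<open>w\<close>-quantile and at least
  \<open>j\<close> of them exceed the level. It is not normalised by \<open>w ^ N\<close>.\<close>

definition binomial_tail :: "nat \<Rightarrow> nat \<Rightarrow> real \<Rightarrow> real \<Rightarrow> real" where
  "binomial_tail N j w v = (\<Sum>i=j..N. real (N choose i) * (w - v) ^ i * v ^ (N - i))"

lemma binomial_tail_0 [simp]: "binomial_tail N 0 w v = w ^ N"
  using binomial_ring[of "w - v" v N] by (simp add: binomial_tail_def atMost_atLeast0)

lemma binomial_tail_eq_0 [simp]: "N < j \<Longrightarrow> binomial_tail N j w v = 0"
  by (simp add: binomial_tail_def)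

lemma binomial_tail_diag [simp]: "0 < j \<Longrightarrow> binomial_tail N j v v = 0"
  by (auto simp: binomial_tail_def intro!: sum.neutral)

lemma binomial_tail_nonneg: "0 \<le> v \<Longrightarrow> v \<le> w \<Longrightarrow> 0 \<le> binomial_tail N j w v"
  by (auto simp: binomial_tail_def intro!: sum_nonneg)

lemma binomial_tail_Suc_le: "0 \<le> v \<Longrightarrow> v \<le> w \<Longrightarrow> binomial_tail N (Suc j) w v \<le> binomial_tail N j w v"
  unfolding binomial_tail_def by (rule sum_mono2) auto

lemma binomial_tail_le: "0 \<le> v \<Longrightarrow> v \<le> w \<Longrightarrow> binomial_tail N j w v \<le> w ^ N"
proof (induction j)
  case (Suc j)
  then show ?case using binomial_tail_Suc_le[of v w N j] by simp
qed simp

lemma binomial_tail_mono: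
  "0 \<le> v \<Longrightarrow> v \<le> w \<Longrightarrow> w \<le> w' \<Longrightarrow> binomial_tail N j w v \<le> binomial_tail N j w' v"
  unfolding binomial_tail_def by (intro sum_mono mult_right_mono mult_left_mono power_mono) auto

text \<open>Condition on one of the bids: with weight \<open>w - v\<close> it exceeds the level and
  leaves \<open>j\<close> exceedances to find among the others, with weight \<open>v\<close> it does
  not. Algebraically this is Pascal's rule.\<close>

lemma binomial_tail_Suc:
  "binomial_tail (Suc N) (Suc j) w v = (w - v) * binomial_tail N j w v + v * binomial_tail N (Suc j) w v"
proof (cases "j \<le> N")
  case True
  have "binomial_tail (Suc N) (Suc j) w v
    = (\<Sum>i=j..N. real (Suc N choose Suc i) * (w - v) ^ Suc i * v ^ (N - i))"
    unfolding binomial_tail_def by (subst sum.shift_bounds_cl_Suc_ivl) simp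
  also have "\<dots> = (w - v) * binomial_tail N j w v
    + (\<Sum>i=j..N. real (N choose Suc i) * (w - v) ^ Suc i * v ^ (N - i))"
    by (simp add: binomial_tail_def sum_distrib_left sum.distrib[symmetric] algebra_simps)
  also have "(\<Sum>i=j..N. real (N choose Suc i) * (w - v) ^ Suc i * v ^ (N - i))
    = (\<Sum>i=Suc j..Suc N. real (N choose i) * (w - v) ^ i * v ^ (Suc N - i))"
    by (subst sum.shift_bounds_cl_Suc_ivl) simp
  also have "\<dots> = (\<Sum>i=Suc j..N. real (N choose i) * (w - v) ^ i * v ^ (Suc N - i))"
    using True by simp
  also have "\<dots> = v * binomial_tail N (Suc j) w v"
    by (auto simp: binomial_tail_def sum_distrib_left Suc_diff_le intro!: sum.cong)
  finally show ?thesis .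
qed simp

text \<open>Moving \<open>w\<close> places one of the \<open>Suc N\<close> bids at the
  \<open>w\<close>-quantile, and that bid is one of the exceedances; hence both indices drop by one.
  The coefficients match by the absorption identity.\<close>

lemma has_real_derivative_binomial_tail:
  "((\<lambda>w. binomial_tail (Suc N) (Suc j) w v) has_real_derivative Suc N * binomial_tail N j w v) (at w within S)"
proof -
  have e: "(\<lambda>w. binomial_tail (Suc N) (Suc j) w v)
    = (\<lambda>w. \<Sum>i=j..N. real (Suc N choose Suc i) * (w - v) ^ Suc i * v ^ (N - i))"
    unfolding binomial_tail_def by (subst sum.shift_bounds_cl_Suc_ivl) simp
  have "real (Suc i) * real (Suc N choose Suc i) = real (Suc N) * real (N choose i)" for i
    by (metis Suc_times_binomial of_nat_mult)
  then show ?thesis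
    unfolding e
    by (auto intro!: derivative_eq_intros sum.cong simp: binomial_tail_def sum_distrib_left simp del: of_nat_Suc binomial_Suc_Suc power_Suc)
qed

lemma integral_binomial_tail:
  assumes "v \<le> w"
  shows "((\<lambda>s. Suc N * binomial_tail N j s v) has_integral binomial_tail (Suc N) (Suc j) w v) {v..w}"
  using fundamental_theorem_of_calculus[OF assms, of "\<lambda>w. binomial_tail (Suc N) (Suc j) w v"]
    has_real_derivative_binomial_tail[of N j v]
  by (simp add: has_real_derivative_iff_has_vector_derivative)

text \<open>The ratio is the chance of at least \<open>j\<close> successes in \<open>N\<close>
  trials with success probability \<open>1 - v / w\<close>, which grows with \<open>w\<close>. In
  the induction step the recursion is a convex combination; lowering the weight \<open>v / w\<close>
  shifts mass from \<open>\<rho> w (Suc i)\<close> to the larger \<open>\<rho> w i\<close>.\<close>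

lemma binomial_tail_ratio_mono:
  assumes "0 \<le> v" "v < w" "w \<le> w'"
  shows "binomial_tail N j w v / w ^ N \<le> binomial_tail N j w' v / w' ^ N"
proof (induction N arbitrary: j)
  case 0
  show ?case by (simp add: binomial_tail_def)
next
  case (Suc N)
  show ?case
  proof (cases j)
    case 0
    then show ?thesis using assms by simp
  next
    case (Suc i)
    define \<rho> where "\<rho> w j = binomial_tail N j w v / w ^ N" for w j
    have rec: "binomial_tail (Suc N) j x v / x ^ Suc N = (1 - v / x) * \<rho> x i + v / x * \<rho> x (Suc i)"
      if "x > 0" for x
      using that by (simp add: Suc binomial_tail_Suc \<rho>_def field_simps)
    have t: "v / w' \<le> v / w" "v / w' \<le> 1"
      using assms by (auto intro: divide_left_mono)
    have d: "\<rho> w (Suc i) \<le> \<rho> w i"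
      using binomial_tail_Suc_le[of v w N i] assms by (simp add: \<rho>_def divide_right_mono)
    have "(1 - v / w) * \<rho> w i + v / w * \<rho> w (Suc i)
      = (1 - v / w') * \<rho> w i + v / w' * \<rho> w (Suc i) - (v / w - v / w') * (\<rho> w i - \<rho> w (Suc i))"
      by (simp add: algebra_simps)
    also have "\<dots> \<le> (1 - v / w') * \<rho> w i + v / w' * \<rho> w (Suc i)"
      using mult_nonneg_nonneg[of "v / w - v / w'" "\<rho> w i - \<rho> w (Suc i)"] t d by simp
    also have "\<dots> \<le> (1 - v / w') * \<rho> w' i + v / w' * \<rho> w' (Suc i)"
      using Suc.IH[of i] Suc.IH[of "Suc i"] t assms
      by (intro add_mono mult_left_mono) (auto simp: \<rho>_def)
    finally show ?thesis using rec[of w] rec[of w'] assms by simp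
  qed
qed

text \<open>
  If bids have the continuous distribution function \<open>G\<close>, then \<open>tail_price G Z N j w\<close> is the expectation
  of the \<open>j\<close>th highest of \<open>N\<close> bids on the event that all of them lie below the \<open>w\<close>-quantile, written as a
  layer-cake integral; the cut-off \<open>Z\<close> is immaterial as soon as \<open>w \<le> G Z\<close>.
\<close>

definition tail_price :: "(real \<Rightarrow> real) \<Rightarrow> real \<Rightarrow> nat \<Rightarrow> nat \<Rightarrow> real \<Rightarrow> real" where
  "tail_price G Z N j w = integral {0..Z} (\<lambda>z. if G z < w then binomial_tail N j w (G z) else 0)"

text \<open>Monotonicity replaces continuity of \<open>h\<close> in the fundamental theorem of calculus.\<close>

lemma integral_mono_eq_deriv:
  fixes h H :: "real \<Rightarrow> real"
  assumes w: "0 < w" "w < b"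
    and mono: "\<And>x y. 0 \<le> x \<Longrightarrow> x \<le> y \<Longrightarrow> y < b \<Longrightarrow> h x \<le> h y"
    and int: "\<And>x y. 0 \<le> x \<Longrightarrow> x \<le> y \<Longrightarrow> y < b \<Longrightarrow> (h has_integral H y - H x) {x..y}"
    and H: "(H has_real_derivative d) (at w)"
  shows "h w = d"
proof -
  have lim: "((\<lambda>y. (H y - H w) / (y - w)) \<longlongrightarrow> d) (at w)"
    using H by (simp add: has_field_derivative_iff)
  have bnd: "h x * (y - x) \<le> H y - H x" "H y - H x \<le> h y * (y - x)" if "0 \<le> x" "x \<le> y" "y < b" for x y
  proof -
    have c: "((\<lambda>_. a) has_integral a * (y - x)) {x..y}" for a
      using has_integral_const_real[of a x y] that by (simp add: mult.commute)
    show "h x * (y - x) \<le> H y - H x"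
      by (rule has_integral_le[OF c int]) (use that mono in auto)
    show "H y - H x \<le> h y * (y - x)"
      by (rule has_integral_le[OF int c]) (use that mono in auto)
  qed
  have "h w \<le> d"
  proof (rule tendsto_lowerbound)
    show "((\<lambda>y. (H y - H w) / (y - w)) \<longlongrightarrow> d) (at_right w)"
      using lim by (rule filterlim_mono) (auto simp: at_le)
    show "\<forall>\<^sub>F y in at_right w. h w \<le> (H y - H w) / (y - w)"
      unfolding eventually_at_right_field using w bnd[of w]
      by (intro exI[of _ b]) (auto simp: field_simps)
  qed simp
  moreover have "d \<le> h w"
  proof (rule tendsto_upperbound)
    show "((\<lambda>y. (H y - H w) / (y - w)) \<longlongrightarrow> d) (at_left w)"
      using lim by (rule filterlim_mono) (auto simp: at_le)
    show "\<forall>\<^sub>F y in at_left w. (H y - H w) / (y - w) \<le> h w"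
      unfolding eventually_at_left_field using w bnd[of _ w]
      by (intro exI[of _ 0]) (auto simp: field_simps)
  qed simp
  ultimately show ?thesis by simp
qed

lemma has_integral_power_Icc:
  assumes "w \<le> w'"
  shows "((\<lambda>v::real. Suc N * (c * v ^ N)) has_integral c * (w' ^ Suc N - w ^ Suc N)) {w..w'}"
proof -
  have "((\<lambda>v. c * v ^ Suc N) has_real_derivative Suc N * (c * v ^ N)) (at v within {w..w'})" for v
    by (auto intro!: derivative_eq_intros simp del: power_Suc)
  with fundamental_theorem_of_calculus[OF assms, of "\<lambda>v. c * v ^ Suc N"]
  show ?thesis
    by (simp add: has_real_derivative_iff_has_vector_derivative right_diff_distrib del: power_Suc of_nat_Suc)
qed

context
  fixes G :: "real \<Rightarrow> real" and Z :: real
  assumes G_mono: "mono G" and G_nonneg: "\<And>z. 0 \<le> G z"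
begin

lemma tail_price_integrand_bound:
  "\<bar>if G z < w then binomial_tail N j w (G z) else 0\<bar> \<le> \<bar>w\<bar> ^ N"
  using binomial_tail_nonneg[of "G z" w N j] binomial_tail_le[of "G z" w N j] G_nonneg[of z] by auto

lemma tail_price_integrand_measurable:
  "(\<lambda>(w, z). if G z < w then binomial_tail N j w (G z) else 0) \<in> borel_measurable (borel \<Otimes>\<^sub>M borel)"
proof -
  have [measurable]: "G \<in> borel_measurable borel"
    by (rule borel_measurable_mono[OF G_mono])
  show ?thesis unfolding binomial_tail_def by measurable
qed

lemma tail_price_integrable:
  "(\<lambda>z. if G z < w then binomial_tail N j w (G z) else 0) integrable_on {0..Z}"
  using measurable_compose[OF measurable_Pair1' tail_price_integrand_measurable[of N j], of w]
  by (intro bounded_borel_integrable_on_Icc[of _ _ _ "\<bar>w\<bar> ^ N"] tail_price_integrand_bound) auto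

lemma tail_price_nonneg: "0 \<le> tail_price G Z N j w"
  unfolding tail_price_def
  by (intro integral_nonneg tail_price_integrable) (auto simp: binomial_tail_nonneg G_nonneg)

lemma tail_price_zero [simp]: "tail_price G Z N j 0 = 0"
  using G_nonneg by (simp add: tail_price_def not_less[symmetric])

lemma tail_price_mono: "w \<le> w' \<Longrightarrow> tail_price G Z N j w \<le> tail_price G Z N j w'"
  unfolding tail_price_def
  by (intro integral_le tail_price_integrable)
     (auto simp: binomial_tail_nonneg G_nonneg intro: binomial_tail_mono)

text \<open>\<open>tail_price G Z 0 0 w\<close> is the length of the initial segment of
  \<open>{0..Z}\<close> on which \<open>G z < w\<close>, that is, the \<open>w\<close>-quantile of
  the bids capped at \<open>Z\<close>.\<close>

lemma tail_price_0: "tail_price G Z N 0 w = w ^ N * tail_price G Z 0 0 w"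
proof -
  have "tail_price G Z N 0 w = integral {0..Z} (\<lambda>z. w ^ N * (if G z < w then binomial_tail 0 0 w (G z) else 0))"
    unfolding tail_price_def by (rule integral_cong) simp
  then show ?thesis by (simp add: tail_price_def)
qed

lemma tail_price_integrable_on: "tail_price G Z N j integrable_on {w..w'}"
  by (rule integrable_on_mono_on) (auto simp: mono_on_def tail_price_mono)

text \<open>Exchange the integrals over \<open>s\<close> and \<open>z\<close>. For fixed
  \<open>z\<close> the integrand vanishes up to \<open>s = G z\<close>, where the higher tail is
  also zero, and from there on it is the derivative of that tail.\<close>

lemma tail_price_Suc:
  assumes "0 \<le> w"
  shows "tail_price G Z (Suc N) (Suc j) w = Suc N * integral {0..w} (tail_price G Z N j)"
proof -
  let ?f = "\<lambda>s z. if G z < s then binomial_tail N j s (G z) else 0"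
  let ?M = "restrict_space lborel {0..w}"
  have fm: "(\<lambda>s. ?f s z) \<in> borel_measurable borel" for z
    using measurable_compose[OF measurable_Pair2' tail_price_integrand_measurable[of N j], of z] by simp
  have bnd: "\<bar>?f s z\<bar> \<le> w ^ N" if "s \<in> {0..w}" for s z
    using tail_price_integrand_bound[of z s N j] power_mono[of s w N] that by auto
  have "(\<lambda>x. x) \<in> measurable (?M \<Otimes>\<^sub>M borel) (borel \<Otimes>\<^sub>M borel)"
    by (auto simp: measurable_pair_iff comp_def intro!: measurable_compose[OF measurable_fst] measurable_restrict_space1)
  from measurable_compose[OF this tail_price_integrand_measurable[of N j]]
  have m: "case_prod ?f \<in> borel_measurable (?M \<Otimes>\<^sub>M borel)" by simp
  have "integral {0..w} (tail_price G Z N j) = (\<integral>s. tail_price G Z N j s \<partial>?M)"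
    by (rule integral_Icc_eq_restrict_lborel[of _ _ _ "tail_price G Z N j w"])
       (auto simp: tail_price_nonneg tail_price_mono abs_of_nonneg intro!: borel_measurable_mono monoI)
  also have "\<dots> = integral {0..Z} (\<lambda>z. \<integral>s. ?f s z \<partial>?M)"
    unfolding tail_price_def
    by (rule integral_swap_Icc[OF finite_measure_restrict_Icc m, where B = "w ^ N"]) (rule bnd, simp)
  also have "\<dots> = integral {0..Z} (\<lambda>z. integral {0..w} (\<lambda>s. ?f s z))"
    by (intro integral_cong integral_Icc_eq_restrict_lborel[symmetric, of _ _ _ "w ^ N"] fm bnd)
  also have "Suc N * \<dots> = integral {0..Z} (\<lambda>z. Suc N * integral {0..w} (\<lambda>s. ?f s z))"
    by simp
  also have "\<dots> = tail_price G Z (Suc N) (Suc j) w"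
    unfolding tail_price_def
  proof (intro integral_cong)
    fix z
    show "Suc N * integral {0..w} (\<lambda>s. ?f s z) = (if G z < w then binomial_tail (Suc N) (Suc j) w (G z) else 0)"
    proof (cases "G z < w")
      case False
      then have "integral {0..w} (\<lambda>s. ?f s z) = integral {0..w} (\<lambda>s. 0)"
        by (intro integral_cong) auto
      with False show ?thesis by simp
    next
      case True
      have "((\<lambda>s. Suc N * ?f s z) has_integral binomial_tail (Suc N) (Suc j) w (G z)) {G z..w}"
        by (rule has_integral_spike_finite[OF _ _ integral_binomial_tail, of "{G z}"]) (use True in auto)
      moreover have "((\<lambda>s. Suc N * ?f s z) has_integral 0) {0..G z}"
        by (rule has_integral_is_0) auto
      ultimately have "((\<lambda>s. Suc N * ?f s z) has_integral 0 + binomial_tail (Suc N) (Suc j) w (G z)) {0..w}"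
        using True G_nonneg by (intro has_integral_combine[of 0 "G z" w]) auto
      from integral_unique[OF this] True show ?thesis by (simp del: of_nat_Suc)
    qed
  qed
  finally show ?thesis ..
qed

text \<open>The identity is kept in integrated form because the integrand need not be continuous:
  for \<open>j = 0\<close> it can jump at a level where \<open>G\<close> is flat.\<close>

lemma tail_price_diff:
  assumes "0 \<le> w" "w \<le> w'"
  shows "((\<lambda>v. Suc N * tail_price G Z N j v) has_integral
    tail_price G Z (Suc N) (Suc j) w' - tail_price G Z (Suc N) (Suc j) w) {w..w'}"
proof -
  have "integral {0..w'} (tail_price G Z N j)
    = integral {0..w} (tail_price G Z N j) + integral {w..w'} (tail_price G Z N j)"
    using assms by (intro Henstock_Kurzweil_Integration.integral_combine[symmetric] tail_price_integrable_on) auto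
  then have "tail_price G Z (Suc N) (Suc j) w' - tail_price G Z (Suc N) (Suc j) w
    = Suc N * integral {w..w'} (tail_price G Z N j)"
    using assms by (simp add: tail_price_Suc algebra_simps del: of_nat_Suc)
  then show ?thesis
    using has_integral_mult_right[OF integrable_integral[OF tail_price_integrable_on], of "Suc N"] by simp
qed

text \<open>Up to the factor \<open>Suc N\<close>, \<open>x * v ^ N - tail_price G Z N j v\<close>
  is the marginal payoff of type \<open>x\<close> at quantile \<open>v\<close>; its sign is
  integrated here. The bound is assumed only between the endpoints, so the integrand is altered at
  them.\<close>

lemma tail_price_diff_le:
  assumes "0 \<le> w" "w \<le> w'" "\<And>v. w < v \<Longrightarrow> v < w' \<Longrightarrow> tail_price G Z N j v \<le> x * v ^ N"
  shows "tail_price G Z (Suc N) (Suc j) w' - tail_price G Z (Suc N) (Suc j) w \<le> x * (w' ^ Suc N - w ^ Suc N)"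
proof (rule has_integral_le[OF _ has_integral_power_Icc])
  show "((\<lambda>v. if v \<in> {w, w'} then Suc N * (x * v ^ N) else Suc N * tail_price G Z N j v) has_integral
    tail_price G Z (Suc N) (Suc j) w' - tail_price G Z (Suc N) (Suc j) w) {w..w'}"
    by (rule has_integral_spike_finite[OF _ _ tail_price_diff, of "{w, w'}"]) (use assms in auto)
qed (use assms in \<open>auto simp del: of_nat_Suc\<close>)

lemma tail_price_diff_ge:
  assumes "0 \<le> w" "w \<le> w'" "\<And>v. w < v \<Longrightarrow> v < w' \<Longrightarrow> x * v ^ N \<le> tail_price G Z N j v"
  shows "x * (w' ^ Suc N - w ^ Suc N) \<le> tail_price G Z (Suc N) (Suc j) w' - tail_price G Z (Suc N) (Suc j) w"
proof (rule has_integral_le[OF has_integral_power_Icc])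
  show "((\<lambda>v. if v \<in> {w, w'} then Suc N * (x * v ^ N) else Suc N * tail_price G Z N j v) has_integral
    tail_price G Z (Suc N) (Suc j) w' - tail_price G Z (Suc N) (Suc j) w) {w..w'}"
    by (rule has_integral_spike_finite[OF _ _ tail_price_diff, of "{w, w'}"]) (use assms in auto)
qed (use assms in \<open>auto simp del: of_nat_Suc\<close>)

lemma continuous_on_tail_price: "continuous_on {0..w} (tail_price G Z (Suc N) (Suc j))"
proof -
  have "continuous_on {0..w} (\<lambda>v. Suc N * integral {0..v} (tail_price G Z N j))"
    by (intro continuous_intros indefinite_integral_continuous_1 tail_price_integrable_on)
  then show ?thesis
    by (rule continuous_on_eq) (simp add: tail_price_Suc)
qed

text \<open>The ratio is the conditional expected price \<open>m w\<close> of the overview. Its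
  monotonicity holds pointwise under the layer-cake integral.\<close>

lemma tail_price_ratio_mono:
  assumes "0 \<le> w" "w \<le> w'" "0 < N"
  shows "tail_price G Z N j w / w ^ N \<le> tail_price G Z N j w' / w' ^ N"
proof (cases "w = 0")
  case True
  then show ?thesis using assms by (simp add: tail_price_nonneg)
next
  case False
  let ?f = "\<lambda>w z. if G z < w then binomial_tail N j w (G z) else 0"
  have "integral {0..Z} (\<lambda>z. ?f w z / w ^ N) \<le> integral {0..Z} (\<lambda>z. ?f w' z / w' ^ N)"
  proof (intro integral_le)
    fix z
    show "?f w z / w ^ N \<le> ?f w' z / w' ^ N"
      using binomial_tail_ratio_mono[of "G z" w w' N j] G_nonneg[of z] assms
      by (auto simp: binomial_tail_nonneg)
  qed (intro integrable_on_divide tail_price_integrable)+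
  then show ?thesis by (simp add: tail_price_def)
qed

end

lemma tail_price_cong_bound:
  assumes "mono G" "\<And>z. 0 \<le> G z" "w \<le> G Z" "0 \<le> Z" "Z \<le> Z'"
  shows "tail_price G Z N j w = tail_price G Z' N j w"
proof -
  let ?f = "\<lambda>z. if G z < w then binomial_tail N j w (G z) else 0"
  have "integral {Z..Z'} ?f = integral {Z..Z'} (\<lambda>z. 0)"
    using order_trans[OF assms(3) monoD[OF assms(1)]] by (intro integral_cong) (auto simp: not_less[symmetric])
  moreover have "integral {0..Z'} ?f = integral {0..Z} ?f + integral {Z..Z'} ?f"
    using assms by (intro Henstock_Kurzweil_Integration.integral_combine[symmetric] tail_price_integrable) auto
  ultimately show ?thesis by (simp add: tail_price_def)
qed

subsection \<open>The expected payoff\<close>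

text \<open>Turns the order statistic into a count, the form that the layer-cake integral needs. In
  the ascending list the \<open>k\<close> highest bids occupy the positions \<open>n - k\<close> to
  \<open>n - 1\<close>.\<close>

lemma less_kth_highest_bid_iff:
  assumes "1 \<le> k" "k \<le> n"
  shows "z < kth_highest_bid n k b \<longleftrightarrow> k \<le> card {j. j < n \<and> z < b j}"
proof -
  define ys where "ys = sort (map b [0..<n])"
  have len: "length ys = n" and sorted: "sorted ys" by (simp_all add: ys_def)
  have kth: "kth_highest_bid n k b = ys ! (n - k)"
    using assms by (simp add: kth_highest_bid_def ys_def rev_nth)
  have "card {j. j < n \<and> z < b j} = length (filter (\<lambda>y. z < y) (map b [0..<n]))"
    by (simp add: length_filter_conv_card del: filter_map cong: conj_cong)
  also have "\<dots> = length (filter (\<lambda>y. z < y) ys)"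
    unfolding ys_def by (metis mset_filter mset_sort size_mset)
  also have "\<dots> = card {j. j < n \<and> z < ys ! j}"
    by (simp add: length_filter_conv_card len)
  finally have card: "card {j. j < n \<and> z < b j} = card {j. j < n \<and> z < ys ! j}" .
  show ?thesis
  proof
    assume z: "z < kth_highest_bid n k b"
    have "{n - k..<n} \<subseteq> {j. j < n \<and> z < ys ! j}"
      using z sorted_nth_mono[OF sorted, of "n - k"] unfolding kth by (fastforce simp: len)
    from card_mono[OF _ this] show "k \<le> card {j. j < n \<and> z < b j}"
      using assms by (simp add: card)
  next
    assume k: "k \<le> card {j. j < n \<and> z < b j}"
    show "z < kth_highest_bid n k b"
    proof (rule ccontr)
      assume z: "\<not> z < kth_highest_bid n k b"
      have "{j. j < n \<and> z < ys ! j} \<subseteq> {n - k<..<n}"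
      proof
        fix j assume j: "j \<in> {j. j < n \<and> z < ys ! j}"
        show "j \<in> {n - k<..<n}"
        proof (rule ccontr)
          assume "j \<notin> {n - k<..<n}"
          with j have "ys ! j \<le> ys ! (n - k)"
            using assms by (intro sorted_nth_mono[OF sorted]) (auto simp: len)
          with j z show False by (simp add: kth)
        qed
      qed
      from card_mono[OF _ this] show False using k assms by (simp add: card)
    qed
  qed
qed

text \<open>
  The expectation of \<open>\<theta> ^ N\<close> over a uniform \<open>\<theta>\<close> is \<open>1 / (N + 1)\<close>, the chance of winning a tie
  against \<open>N\<close> opponents.
\<close>

definition tie_weight :: "real \<Rightarrow> real \<Rightarrow> real \<Rightarrow> real" where
  "tie_weight \<theta> a y = (if y < a then 1 else if y = a then \<theta> else 0)"

lemma integral_less_eq: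
  assumes "0 \<le> p" "p \<le> a"
  shows "integral {0..a} (\<lambda>z::real. of_bool (z < p)) = p"
proof -
  have "((\<lambda>z. of_bool (z < p)) has_integral p) {0..p}"
    by (rule has_integral_spike_finite[of "{p}" _ _ "\<lambda>_. 1"])
       (use assms has_integral_const_real[of "1::real" 0 p] in auto)
  moreover have "((\<lambda>z. of_bool (z < p)) has_integral 0) {p..a}"
    by (rule has_integral_is_0) auto
  ultimately have "((\<lambda>z. of_bool (z < p)) has_integral p + 0) {0..a}"
    using assms by (intro has_integral_combine[of 0 p a])
  then show ?thesis by (simp add: integral_unique)
qed

text \<open>With the tie-breaking written as an integral over \<open>\<theta>\<close> and the price
  as an integral over \<open>z\<close>, the payoff is built from a product over the opponents and a
  count of them, so that independence can be applied. The product is \<open>0\<close> if bidder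
  \<open>i\<close> is outbid and otherwise \<open>\<theta>\<close> to the number of opponents tied
  with him.\<close>

lemma auction_payoff_eq_integral:
  assumes i: "i < n" and k: "1 \<le> k" "k \<le> n" and b: "\<And>j. j < n \<Longrightarrow> 0 \<le> b j"
  defines "J \<equiv> {..<n} - {i}"
  shows "auction_payoff n k i x b = integral {0..1} (\<lambda>\<theta>. (\<Prod>j\<in>J. tie_weight \<theta> (b i) (b j)) *
    (x - integral {0..b i} (\<lambda>z. of_bool (k - 1 \<le> card {j\<in>J. z < b j}))))"
proof (cases "\<exists>j\<in>J. b i < b j")
  case True
  then obtain j where j: "j \<in> J" "b i < b j" by blast
  then have "(\<Prod>j\<in>J. tie_weight \<theta> (b i) (b j)) = 0" for \<theta>
    by (intro prod_zero) (auto simp: tie_weight_def J_def intro!: bexI[of _ j])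
  moreover have "i \<notin> highest_bidders n b"
    using j by (force simp: highest_bidders_def J_def)
  ultimately show ?thesis by (simp add: auction_payoff_def)
next
  case False
  define T where "T = {j\<in>J. b j = b i}"
  have fin: "finite J" by (simp add: J_def)
  have le: "b j \<le> b i" if "j < n" for j
    using False that by (cases "j = i") (auto simp: J_def not_less)
  have hb: "highest_bidders n b = insert i T"
    using i le by (auto simp: highest_bidders_def T_def J_def intro: antisym)
  have "(\<Prod>j\<in>J. tie_weight \<theta> (b i) (b j)) = (\<Prod>j\<in>J. if j \<in> T then \<theta> else 1)" for \<theta>
    using le by (intro prod.cong) (force simp: tie_weight_def T_def J_def)+
  then have prod: "(\<Prod>j\<in>J. tie_weight \<theta> (b i) (b j)) = \<theta> ^ card T" for \<theta>
    using fin by (simp add: prod.If_cases T_def Int_def)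
  define p where "p = kth_highest_bid n k b"
  have pz: "z < p \<longleftrightarrow> k \<le> card {j. j < n \<and> z < b j}" for z
    unfolding p_def by (rule less_kth_highest_bid_iff[OF k])
  have "{j. j < n \<and> b i < b j} = {}"
    unfolding Collect_empty_eq using le not_le by blast
  then have "card {j. j < n \<and> b i < b j} = 0" by (simp only: card.empty)
  then have "\<not> b i < p"
    unfolding pz using k by linarith
  moreover have "\<not> p < 0"
  proof
    assume "p < 0"
    then have "{j. j < n \<and> p < b j} = {..<n}" using b by force
    with pz[of p] k show False by simp
  qed
  moreover have "integral {0..b i} (\<lambda>z. of_bool (k - 1 \<le> card {j\<in>J. z < b j}) :: real)
    = integral {0..b i} (\<lambda>z. of_bool (z < p))"
  \<comment> \<open>For \<open>z < b i\<close> bidder \<open>i\<close> is himself among the bids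
    above \<open>z\<close>, so \<open>k - 1\<close> opponents complete the count. At
    \<open>z = b i\<close> he is not, and this point is removed.\<close>
  proof (rule integral_spike[of "{b i}"])
    fix z assume z: "z \<in> {0..b i} - {b i}"
    then have e: "{j. j < n \<and> z < b j} = insert i {j\<in>J. z < b j}"
      using i by (auto simp: J_def)
    have "card {j. j < n \<and> z < b j} = Suc (card {j\<in>J. z < b j})"
      unfolding e using fin by (subst card_insert_disjoint) (auto simp: J_def)
    then have "z < p \<longleftrightarrow> k - 1 \<le> card {j\<in>J. z < b j}"
      unfolding pz using k by linarith
    then show "of_bool (z < p) = (of_bool (k - 1 \<le> card {j\<in>J. z < b j}) :: real)" by simp
  qed simp
  ultimately have p: "integral {0..b i} (\<lambda>z. of_bool (k - 1 \<le> card {j\<in>J. z < b j})) = p"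
    by (simp add: integral_less_eq)
  have "((\<lambda>\<theta>::real. \<theta> ^ card T) has_integral 1 / real (Suc (card T))) {0..1}"
    using has_integral_power_Icc[of 0 1 "card T" "1 / real (Suc (card T))"] by (simp del: of_nat_Suc)
  then have "((\<lambda>\<theta>. \<theta> ^ card T * (x - p)) has_integral 1 / real (Suc (card T)) * (x - p)) {0..1}"
    by (rule has_integral_mult_left)
  from integral_unique[OF this]
  have "integral {0..1} (\<lambda>\<theta>. \<theta> ^ card T * (x - p)) = (x - p) / real (Suc (card T))" by simp
  moreover have "card (highest_bidders n b) = Suc (card T)"
    using fin by (simp add: hb T_def J_def)
  ultimately show ?thesis
    using hb unfolding auction_payoff_def prod p p_def[symmetric] by simp
qed

lemma sum_subsets_eq_binomial_tail:
  assumes "finite J"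
  shows "(\<Sum>A | A \<subseteq> J \<and> \<kappa> \<le> card A. (w - v) ^ card A * v ^ (card J - card A)) = binomial_tail (card J) \<kappa> w v"
proof -
  let ?S = "{A. A \<subseteq> J \<and> \<kappa> \<le> card A}"
  have "(\<Sum>A\<in>?S. (w - v) ^ card A * v ^ (card J - card A))
    = (\<Sum>i\<in>{\<kappa>..card J}. \<Sum>A\<in>{A\<in>?S. card A = i}. (w - v) ^ card A * v ^ (card J - card A))"
    using assms by (intro sum.group[symmetric]) (auto intro: card_mono)
  also have "\<dots> = (\<Sum>i\<in>{\<kappa>..card J}. \<Sum>A\<in>{A. A \<subseteq> J \<and> card A = i}. (w - v) ^ i * v ^ (card J - i))"
    by (intro sum.cong refl) auto
  also have "\<dots> = binomial_tail (card J) \<kappa> w v"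
    using assms by (simp add: n_subsets binomial_tail_def mult.assoc)
  finally show ?thesis .
qed

section \<open>Expectations over independent, identically distributed opponents\<close>

context prob_space
begin

context
  fixes Y :: "nat \<Rightarrow> 'a \<Rightarrow> real" and n :: nat and D :: "real measure"
  assumes indep: "indep_vars (\<lambda>_. borel) Y {..<n}"
    and distr: "\<And>j. j < n \<Longrightarrow> distr M borel (Y j) = D"
begin

lemma iid_measurable: "j < n \<Longrightarrow> Y j \<in> borel_measurable M"
  using indep by (auto simp: indep_vars_def)

lemma integral_iid:
  fixes f :: "real \<Rightarrow> real"
  assumes "j < n" "f \<in> borel_measurable borel"
  shows "(\<integral>\<omega>. f (Y j \<omega>) \<partial>M) = (\<integral>y. f y \<partial>D)"
  using integral_distr[OF iid_measurable assms(2), of j] assms by (simp add: distr)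

lemma expectation_prod_iid:
  fixes f :: "nat \<Rightarrow> real \<Rightarrow> real"
  assumes J: "J \<subseteq> {..<n}" and f: "\<And>j. j \<in> J \<Longrightarrow> f j \<in> borel_measurable borel"
    and B: "\<And>j y. j \<in> J \<Longrightarrow> \<bar>f j y\<bar> \<le> B"
  shows "(\<integral>\<omega>. (\<Prod>j\<in>J. f j (Y j \<omega>)) \<partial>M) = (\<Prod>j\<in>J. \<integral>y. f j y \<partial>D)"
    and "integrable M (\<lambda>\<omega>. \<Prod>j\<in>J. f j (Y j \<omega>))"
proof -
  have fin: "finite J" using J finite_subset by blast
  have ind: "indep_vars (\<lambda>_. borel) (\<lambda>j \<omega>. f j (Y j \<omega>)) J"
    by (rule indep_vars_compose2[OF indep_vars_subset[OF indep J]]) (use f in auto)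
  have int: "integrable M (\<lambda>\<omega>. f j (Y j \<omega>))" if "j \<in> J" for j
    using that J B f by (intro integrable_const_bound[of _ B] AE_I2)
      (auto intro!: measurable_compose[OF iid_measurable])
  show "(\<integral>\<omega>. (\<Prod>j\<in>J. f j (Y j \<omega>)) \<partial>M) = (\<Prod>j\<in>J. \<integral>y. f j y \<partial>D)"
    using J by (subst indep_vars_lebesgue_integral[OF fin ind int]) (auto intro!: prod.cong integral_iid f)
  show "integrable M (\<lambda>\<omega>. \<Prod>j\<in>J. f j (Y j \<omega>))"
    by (rule indep_vars_integrable[OF fin ind int])
qed

text \<open>Sum over the exact set \<open>A\<close> of opponents above \<open>z\<close>; each
  summand is a product over independent opponents. An opponent has mean weight \<open>v\<close> at
  or below \<open>z\<close> and \<open>w - v\<close> above it, where weighting bids equal to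
  \<open>a\<close> by \<open>\<theta>\<close> puts \<open>w\<close> at the fraction
  \<open>\<theta>\<close> of the atom at \<open>a\<close>.\<close>

lemma expectation_tie_weight_count:
  assumes J: "J \<subseteq> {..<n}" "J \<noteq> {}" and \<theta>: "0 \<le> \<theta>" "\<theta> \<le> 1" and z: "z < a"
  shows "(\<integral>\<omega>. (\<Prod>j\<in>J. tie_weight \<theta> a (Y j \<omega>)) * of_bool (\<kappa> \<le> card {j\<in>J. z < Y j \<omega>}) \<partial>M)
    = binomial_tail (card J) \<kappa> (measure D {..<a} + \<theta> * (cdf D a - measure D {..<a})) (cdf D z)"
proof -
  have fin: "finite J" using J finite_subset by blast
  obtain j0 where "j0 < n" using J by auto
  then interpret D: prob_space D
    using prob_space_distr[OF iid_measurable[of j0]] distr by simp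
  have [measurable_cong, simp]: "sets D = sets borel" using distr[OF \<open>j0 < n\<close>] by auto
  have [simp]: "space D = UNIV" using distr[OF \<open>j0 < n\<close>] by auto
  define w where "w = measure D {..<a} + \<theta> * (cdf D a - measure D {..<a})"
  define v where "v = cdf D z"
  define f where "f A j y = (if j \<in> A then tie_weight \<theta> a y * of_bool (z < y) else tie_weight \<theta> a y * of_bool (y \<le> z))"
    for A :: "nat set" and j y
  have f_meas: "f A j \<in> borel_measurable borel" for A j
    unfolding f_def[abs_def] tie_weight_def by measurable
  have f_bound: "\<bar>f A j y\<bar> \<le> 1" for A j y
    using \<theta> by (auto simp: f_def tie_weight_def)
  have lo: "(\<integral>y. tie_weight \<theta> a y * of_bool (y \<le> z) \<partial>D) = v"
  proof -
    have "(\<lambda>y. tie_weight \<theta> a y * of_bool (y \<le> z)) = indicator {..z}"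
      using z by (auto simp: tie_weight_def indicator_def)
    then show ?thesis by (simp add: v_def cdf_def)
  qed
  have hi: "(\<integral>y. tie_weight \<theta> a y * of_bool (z < y) \<partial>D) = w - v"
  proof -
    have e: "tie_weight \<theta> a y * of_bool (z < y) = \<theta> * indicator {..a} y + (1 - \<theta>) * indicator {..<a} y - indicator {..z} y" for y
      using z by (auto simp: tie_weight_def indicator_def)
    have "(\<integral>y. tie_weight \<theta> a y * of_bool (z < y) \<partial>D)
      = \<theta> * measure D {..a} + (1 - \<theta>) * measure D {..<a} - measure D {..z}"
      unfolding e by (simp add: D.emeasure_eq_measure)
    then show ?thesis by (simp add: w_def v_def cdf_def algebra_simps)
  qed
  have expand: "(\<Prod>j\<in>J. tie_weight \<theta> a (Y j \<omega>)) * of_bool (\<kappa> \<le> card {j\<in>J. z < Y j \<omega>})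
    = (\<Sum>A | A \<subseteq> J \<and> \<kappa> \<le> card A. \<Prod>j\<in>J. f A j (Y j \<omega>))" for \<omega>
  proof -
    let ?A = "{j\<in>J. z < Y j \<omega>}" and ?P = "\<Prod>j\<in>J. tie_weight \<theta> a (Y j \<omega>)"
    have "(\<Prod>j\<in>J. f A j (Y j \<omega>)) = (if A = ?A then ?P else 0)" if "A \<subseteq> J" for A
    proof (cases "A = ?A")
      case True
      then show ?thesis by (auto simp: f_def intro!: prod.cong)
    next
      case False
      then have "\<exists>j\<in>J. j \<in> A \<longleftrightarrow> \<not> z < Y j \<omega>" using that by blast
      then have "\<exists>j\<in>J. f A j (Y j \<omega>) = 0" by (auto simp: f_def)
      with False fin show ?thesis by (simp add: prod_zero)
    qed
    then have "(\<Sum>A | A \<subseteq> J \<and> \<kappa> \<le> card A. \<Prod>j\<in>J. f A j (Y j \<omega>))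
      = (\<Sum>A | A \<subseteq> J \<and> \<kappa> \<le> card A. if A = ?A then ?P else 0)"
      by (intro sum.cong) auto
    also have "\<dots> = ?P * of_bool (\<kappa> \<le> card ?A)"
      using fin by (subst sum.delta) auto
    finally show ?thesis ..
  qed
  have "(\<integral>\<omega>. (\<Sum>A | A \<subseteq> J \<and> \<kappa> \<le> card A. \<Prod>j\<in>J. f A j (Y j \<omega>)) \<partial>M)
    = (\<Sum>A | A \<subseteq> J \<and> \<kappa> \<le> card A. \<Prod>j\<in>J. \<integral>y. f A j y \<partial>D)"
    using expectation_prod_iid[OF J(1) f_meas f_bound]
    by (subst Bochner_Integration.integral_sum) auto
  also have "\<dots> = (\<Sum>A | A \<subseteq> J \<and> \<kappa> \<le> card A. (w - v) ^ card A * v ^ (card J - card A))"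
  proof (intro sum.cong refl)
    fix A assume "A \<in> {A. A \<subseteq> J \<and> \<kappa> \<le> card A}"
    then have A: "A \<subseteq> J" by simp
    have "(\<Prod>j\<in>J. \<integral>y. f A j y \<partial>D) = (\<Prod>j\<in>J. if j \<in> A then w - v else v)"
      by (intro prod.cong refl) (auto simp: f_def lo hi)
    also have "\<dots> = (w - v) ^ card A * v ^ (card J - card A)"
      using A fin finite_subset[OF A fin]
      by (simp add: prod.If_cases Int_absorb1 card_Diff_subset Diff_eq[symmetric])
    finally show "(\<Prod>j\<in>J. \<integral>y. f A j y \<partial>D) = (w - v) ^ card A * v ^ (card J - card A)" .
  qed
  also have "\<dots> = binomial_tail (card J) \<kappa> w v"
    by (rule sum_subsets_eq_binomial_tail[OF fin])
  finally show ?thesis by (simp add: expand w_def v_def)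
qed

end

end

text \<open>
  The payoff of type \<open>x\<close> from a bid at quantile \<open>w\<close>. At an atom of the bid distribution the random
  tie-breaking turns into an average over the quantiles that the atom occupies.
\<close>

definition virtual_payoff :: "(real \<Rightarrow> real) \<Rightarrow> real \<Rightarrow> nat \<Rightarrow> nat \<Rightarrow> real \<Rightarrow> real \<Rightarrow> real" where
  "virtual_payoff G Z n k x w = x * w ^ (n - 1) - tail_price G Z (n - 1) (k - 1) w"

text \<open>Fubini moves the expectation inside the \<open>\<theta>\<close>-integral and then inside
  the \<open>z\<close>-integral of the price, where \<open>expectation_tie_weight_count\<close>
  evaluates it.\<close>

lemma (in prob_space) expectation_auction_payoff:
  fixes Y :: "nat \<Rightarrow> 'a \<Rightarrow> real" and n :: nat and D :: "real measure"
  assumes indep: "indep_vars (\<lambda>_. borel) Y {..<n}"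
    and distr: "\<And>j. j < n \<Longrightarrow> distr M borel (Y j) = D"
    and Y_nonneg: "\<And>j \<omega>. j < n \<Longrightarrow> \<omega> \<in> space M \<Longrightarrow> 0 \<le> Y j \<omega>"
    and i: "i < n" and k: "2 \<le> k" "k \<le> n" and a: "0 \<le> a"
  shows "(\<integral>\<omega>. auction_payoff n k i x (\<lambda>j. if j = i then a else Y j \<omega>) \<partial>M)
    = integral {0..1} (\<lambda>\<theta>. virtual_payoff (cdf D) a n k x (measure D {..<a} + \<theta> * (cdf D a - measure D {..<a})))"
proof -
  define J where "J = {..<n} - {i}"
  have J: "J \<subseteq> {..<n}" "finite J" "card J = n - 1"
    using i by (auto simp: J_def)
  then have "J \<noteq> {}" using i k by auto
  note J = J this
  have Y_meas [measurable]: "Y j \<in> borel_measurable M" if "j \<in> J" for j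
    using iid_measurable[OF indep distr] that J by auto
  interpret D: prob_space D
    using prob_space_distr[OF iid_measurable[OF indep distr i]] distr[OF i] by simp
  have sets_D: "sets D = sets borel" using distr[OF i] by auto
  interpret D: finite_borel_measure D
    by standard (simp add: sets_D)
  define w where "w \<theta> = measure D {..<a} + \<theta> * (cdf D a - measure D {..<a})" for \<theta>
  define P where "P \<theta> \<omega> = (\<Prod>j\<in>J. tie_weight \<theta> a (Y j \<omega>))" for \<theta> \<omega>
  define I where "I z \<omega> = (of_bool (k - 1 \<le> card {j\<in>J. z < Y j \<omega>}) :: real)" for z \<omega>
  have P_meas [measurable]: "(\<lambda>(\<omega>, \<theta>). P \<theta> \<omega>) \<in> borel_measurable (M \<Otimes>\<^sub>M borel)"
    unfolding P_def tie_weight_def by measurable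
  have P_meas': "P \<theta> \<in> borel_measurable M" for \<theta>
    unfolding P_def[abs_def] tie_weight_def by measurable
  have P_bound: "0 \<le> P \<theta> \<omega>" "P \<theta> \<omega> \<le> 1" if "\<theta> \<in> {0..1}" for \<theta> \<omega>
    using that by (auto simp: P_def tie_weight_def intro!: prod_nonneg prod_le_1)
  \<comment> \<open>As a finite sum of indicators the count is visibly jointly measurable in
    \<open>\<omega>\<close> and \<open>z\<close>.\<close>
  have card_eq: "real (card {j\<in>J. z < Y j \<omega>}) = (\<Sum>j\<in>J. if z < Y j \<omega> then 1 else 0)" for z \<omega>
    using J(2) by (simp add: sum.If_cases Int_def)
  have I_eq: "I z \<omega> = (if real (k - 1) \<le> (\<Sum>j\<in>J. if z < Y j \<omega> then 1 else 0) then 1 else 0)" for z \<omega>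
    unfolding I_def card_eq[symmetric] of_nat_le_iff by simp
  have I_meas [measurable]: "(\<lambda>(\<omega>, z). I z \<omega>) \<in> borel_measurable (M \<Otimes>\<^sub>M borel)"
    unfolding I_eq by measurable
  have I_meas': "(\<lambda>z. I z \<omega>) \<in> borel_measurable borel" if "\<omega> \<in> space M" for \<omega>
    using measurable_compose[OF measurable_Pair1'[OF that] I_meas] by simp
  have I_bound: "0 \<le> I z \<omega>" "I z \<omega> \<le> 1" for z \<omega> by (auto simp: I_def)
  define c where "c \<omega> = integral {0..a} (\<lambda>z. I z \<omega>)" for \<omega>
  interpret Z: finite_measure "restrict_space lborel {0..a}" by (rule finite_measure_restrict_Icc)
  have c_eq: "c \<omega> = (\<integral>z. I z \<omega> \<partial>restrict_space lborel {0..a})" if "\<omega> \<in> space M" for \<omega>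
    unfolding c_def by (rule integral_Icc_eq_restrict_lborel[OF I_meas'[OF that], of _ _ 1])
      (use I_bound in auto)
  have c_meas [measurable]: "c \<in> borel_measurable M"
  proof -
    have "(\<lambda>x. x) \<in> measurable (M \<Otimes>\<^sub>M restrict_space lborel {0..a}) (M \<Otimes>\<^sub>M borel)"
      by (auto simp: measurable_pair_iff comp_def
          intro!: measurable_compose[OF measurable_snd] measurable_restrict_space1)
    from measurable_compose[OF this I_meas]
    have "(\<lambda>\<omega>. \<integral>z. I z \<omega> \<partial>restrict_space lborel {0..a}) \<in> borel_measurable M"
      by (intro Z.borel_measurable_lebesgue_integral) simp
    then show ?thesis by (subst measurable_cong[OF c_eq])
  qed
  have c_bound: "\<bar>c \<omega>\<bar> \<le> a" if "\<omega> \<in> space M" for \<omega>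
  proof -
    have int: "(\<lambda>z. I z \<omega>) integrable_on {0..a}"
      by (rule bounded_borel_integrable_on_Icc[OF I_meas'[OF that], of _ _ 1]) (use I_bound in auto)
    have "c \<omega> \<le> integral {0..a} (\<lambda>z. 1)"
      unfolding c_def by (rule integral_le[OF int]) (use I_bound in auto)
    moreover have "0 \<le> c \<omega>"
      unfolding c_def by (rule integral_nonneg[OF int]) (use I_bound in auto)
    ultimately show ?thesis using a by simp
  qed
  have payoff: "auction_payoff n k i x (\<lambda>j. if j = i then a else Y j \<omega>)
    = integral {0..1} (\<lambda>\<theta>. P \<theta> \<omega> * (x - c \<omega>))" if "\<omega> \<in> space M" for \<omega>
  proof -
    have e: "(\<Prod>j\<in>J. tie_weight \<theta> a (if j = i then a else Y j \<omega>)) = P \<theta> \<omega>"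
      "{j\<in>J. z < (if j = i then a else Y j \<omega>)} = {j\<in>J. z < Y j \<omega>}" for \<theta> z
      by (auto simp: P_def J_def intro!: prod.cong)
    show ?thesis
      using auction_payoff_eq_integral[of i n k "\<lambda>j. if j = i then a else Y j \<omega>" x] i k a Y_nonneg that
      by (simp add: J_def[symmetric] e I_def c_def)
  qed
  have inner: "(\<integral>\<omega>. P \<theta> \<omega> * (x - c \<omega>) \<partial>M) = virtual_payoff (cdf D) a n k x (w \<theta>)" if \<theta>: "\<theta> \<in> {0..1}" for \<theta>
  proof -
    have int_P: "integrable M (P \<theta>)"
      by (rule integrable_const_bound[of _ 1]) (use P_bound[OF \<theta>] P_meas' in auto)
    have int_Pc: "integrable M (\<lambda>\<omega>. P \<theta> \<omega> * c \<omega>)"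
    proof (rule integrable_const_bound[of _ "1 * a", OF AE_I2])
      show "norm (P \<theta> \<omega> * c \<omega>) \<le> 1 * a" if "\<omega> \<in> space M" for \<omega>
        unfolding real_norm_def abs_mult using P_bound[OF \<theta>, of \<omega>] c_bound[OF that] by (intro mult_mono) auto
    qed (use P_meas' in auto)
    \<comment> \<open>With threshold \<open>0\<close> the count imposes nothing, so any level below
      \<open>a\<close> serves; \<open>a - 1\<close> is one.\<close>
    have Pw: "(\<integral>\<omega>. P \<theta> \<omega> \<partial>M) = w \<theta> ^ (n - 1)"
      using expectation_tie_weight_count[OF indep distr J(1,4), of \<theta> "a - 1" a 0] \<theta>
      by (simp add: J(3) P_def w_def)
    have "(\<integral>\<omega>. P \<theta> \<omega> * c \<omega> \<partial>M) = (\<integral>\<omega>. integral {0..a} (\<lambda>z. P \<theta> \<omega> * I z \<omega>) \<partial>M)"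
      by (simp add: c_def)
    also have "\<dots> = integral {0..a} (\<lambda>z. \<integral>\<omega>. P \<theta> \<omega> * I z \<omega> \<partial>M)"
    proof (rule integral_swap_Icc[where B = 1])
      show "(\<lambda>(\<omega>, z). P \<theta> \<omega> * I z \<omega>) \<in> borel_measurable (M \<Otimes>\<^sub>M borel)"
        using P_meas'[of \<theta>] by measurable
      show "\<bar>P \<theta> \<omega> * I z \<omega>\<bar> \<le> 1" for \<omega> z
        using P_bound[OF \<theta>, of \<omega>] I_bound[of z \<omega>] by (auto simp: abs_mult intro!: mult_le_one)
    qed (rule finite_measure_axioms)
    also have "\<dots> = tail_price (cdf D) a (n - 1) (k - 1) (w \<theta>)"
      unfolding tail_price_def
    proof (rule integral_spike[of "{a}"])
      fix z assume "z \<in> {0..a} - {a}"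
      then have z: "z < a" by auto
      have "cdf D z \<le> measure D {..<a}"
        unfolding cdf_def using z by (intro D.finite_measure_mono) (auto simp: sets_D)
      also have "\<dots> \<le> w \<theta>"
        using \<theta> by (auto simp: w_def cdf_def sets_D intro!: mult_nonneg_nonneg D.finite_measure_mono)
      finally have "cdf D z \<le> w \<theta>" .
      moreover have "(\<integral>\<omega>. P \<theta> \<omega> * I z \<omega> \<partial>M) = binomial_tail (n - 1) (k - 1) (w \<theta>) (cdf D z)"
        using expectation_tie_weight_count[OF indep distr J(1,4) _ _ z, of \<theta> "k - 1"] \<theta>
        by (simp add: J(3) P_def I_def w_def)
      \<comment> \<open>When \<open>cdf D z = w \<theta>\<close> the truncated integrand is
        \<open>0\<close>, and so is the tail on the diagonal because \<open>k - 1\<close> is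
        positive.\<close>
      ultimately show "(if cdf D z < w \<theta> then binomial_tail (n - 1) (k - 1) (w \<theta>) (cdf D z) else 0)
        = (\<integral>\<omega>. P \<theta> \<omega> * I z \<omega> \<partial>M)"
        using k by (cases "cdf D z = w \<theta>") auto
    qed simp
    finally show ?thesis
      using int_P int_Pc Pw by (simp add: right_diff_distrib virtual_payoff_def mult.commute)
  qed
  have "(\<integral>\<omega>. auction_payoff n k i x (\<lambda>j. if j = i then a else Y j \<omega>) \<partial>M)
    = (\<integral>\<omega>. integral {0..1} (\<lambda>\<theta>. P \<theta> \<omega> * (x - c \<omega>)) \<partial>M)"
    by (intro Bochner_Integration.integral_cong refl payoff)
  also have "\<dots> = integral {0..1} (\<lambda>\<theta>. \<integral>\<omega>. P \<theta> \<omega> * (x - c \<omega>) \<partial>M)"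
  proof (rule integral_swap_Icc[where B = "1 * (\<bar>x\<bar> + a)"])
    show "(\<lambda>(\<omega>, \<theta>). P \<theta> \<omega> * (x - c \<omega>)) \<in> borel_measurable (M \<Otimes>\<^sub>M borel)"
      by measurable
    show "\<bar>P \<theta> \<omega> * (x - c \<omega>)\<bar> \<le> 1 * (\<bar>x\<bar> + a)" if "\<omega> \<in> space M" "\<theta> \<in> {0..1}" for \<omega> \<theta>
      unfolding abs_mult using P_bound[OF that(2), of \<omega>] c_bound[OF that(1)] a by (intro mult_mono) auto
  qed (rule finite_measure_axioms)
  also have "\<dots> = integral {0..1} (\<lambda>\<theta>. virtual_payoff (cdf D) a n k x (w \<theta>))"
    by (intro integral_cong inner)
  finally show ?thesis by (simp add: w_def)
qed

section \<open>Averages over an interval of quantiles\<close>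

text \<open>Parametrised by \<open>\<theta>\<close> rather than divided by \<open>g - l\<close>, so
  that a degenerate interval, the case of no atom, gives \<open>f l\<close>.\<close>

definition interval_mean :: "(real \<Rightarrow> real) \<Rightarrow> real \<Rightarrow> real \<Rightarrow> real" where
  "interval_mean f l g = integral {0..1} (\<lambda>\<theta>. f (l + \<theta> * (g - l)))"

lemma interval_mean_refl [simp]: "interval_mean f l l = f l"
  by (simp add: interval_mean_def)

lemma affine_in_Icc: "l \<le> g \<Longrightarrow> \<theta> \<in> {0..1} \<Longrightarrow> l + \<theta> * (g - l) \<in> {l..g}" for l g \<theta> :: real
  using mult_left_le_one_le[of "g - l" \<theta>] by auto

lemma interval_mean_cong:
  assumes "l \<le> g" "\<And>w. l \<le> w \<Longrightarrow> w \<le> g \<Longrightarrow> f w = h w"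
  shows "interval_mean f l g = interval_mean h l g"
  unfolding interval_mean_def using affine_in_Icc[OF assms(1)] by (intro integral_cong assms(2)) auto

context
  fixes l g :: real
  assumes lg: "l \<le> g"
begin

lemma interval_mean_continuous:
  assumes "continuous_on {l..g} f"
  shows "continuous_on {0..1} (\<lambda>\<theta>. f (l + \<theta> * (g - l)))"
  by (rule continuous_on_compose2[OF assms]) (use affine_in_Icc[OF lg] in \<open>auto intro!: continuous_intros\<close>)

lemma interval_mean_le:
  assumes "continuous_on {l..g} f" "\<And>w. l \<le> w \<Longrightarrow> w \<le> g \<Longrightarrow> f w \<le> c"
  shows "interval_mean f l g \<le> c"
proof -
  have "interval_mean f l g \<le> integral {0..1::real} (\<lambda>_. c)"
    unfolding interval_mean_def
    by (intro integral_le integrable_continuous_interval interval_mean_continuous assms)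
       (use affine_in_Icc[OF lg] assms in auto)
  then show ?thesis by simp
qed

lemma interval_mean_ge:
  assumes "continuous_on {l..g} f" "\<And>w. l \<le> w \<Longrightarrow> w \<le> g \<Longrightarrow> c \<le> f w"
  shows "c \<le> interval_mean f l g"
proof -
  have "integral {0..1::real} (\<lambda>_. c) \<le> interval_mean f l g"
    unfolding interval_mean_def
    by (intro integral_le integrable_continuous_interval interval_mean_continuous assms)
       (use affine_in_Icc[OF lg] assms in auto)
  then show ?thesis by simp
qed

lemma interval_mean_less:
  assumes f: "continuous_on {l..g} f" "\<And>w. l \<le> w \<Longrightarrow> w \<le> g \<Longrightarrow> f w \<le> c"
    and w: "l \<le> w" "w \<le> g" "f w < c"
  shows "interval_mean f l g < c"
proof (rule ccontr)
  assume "\<not> interval_mean f l g < c"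
  with interval_mean_le[OF f] have e: "interval_mean f l g = c" by simp
  have cont: "continuous_on {0..1} (\<lambda>\<theta>. c - f (l + \<theta> * (g - l)))"
    by (intro continuous_intros interval_mean_continuous f)
  have "integral {0..1} (\<lambda>\<theta>. c - f (l + \<theta> * (g - l))) = 0"
    using e unfolding interval_mean_def
    by (subst Henstock_Kurzweil_Integration.integral_diff)
       (auto intro!: integrable_continuous_interval interval_mean_continuous f)
  then have all: "\<forall>\<theta>\<in>{0..1}. c - f (l + \<theta> * (g - l)) = 0"
    using affine_in_Icc[OF lg] f by (subst (asm) integral_eq_0_iff[OF cont]) auto
  obtain \<theta> where "\<theta> \<in> {0..1}" "w = l + \<theta> * (g - l)"
  proof (cases "l = g")
    case False
    with lg w show ?thesis by (intro that[of "(w - l) / (g - l)"]) (auto simp: field_simps)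
  qed (use w in \<open>auto intro: that[of 0]\<close>)
  with all w show False by force
qed

lemma interval_mean_diff:
  assumes "continuous_on {l..g} f" "continuous_on {l..g} h"
  shows "interval_mean (\<lambda>w. x * f w - h w) l g = x * interval_mean f l g - interval_mean h l g"
  unfolding interval_mean_def
  by (subst Henstock_Kurzweil_Integration.integral_diff)
     (auto intro!: integrable_continuous_interval interval_mean_continuous continuous_intros assms)

end

subsection \<open>Equilibrium conditions in quantile space\<close>

context real_distribution
begin

lemma lessThan_le_cdf: "measure M {..<a} \<le> cdf M a"
  unfolding cdf_def by (rule finite_measure_mono) auto

lemma cdf_le_lessThan: "a < c \<Longrightarrow> cdf M a \<le> measure M {..<c}"
  unfolding cdf_def by (rule finite_measure_mono) auto

end

text \<open>
  Types are indexed by their quantile \<open>w = F x\<close>, so that the valuation is \<open>w powr s\<close> with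
  \<open>s = 1 / \<alpha>\<close>; \<open>N\<close> and \<open>j\<close> stand for \<open>n - 2\<close> and \<open>k - 2\<close>. The condition \<open>quantile\<close> is all that is
  needed of the fact that \<open>D\<close> is the law of the equilibrium bids.
\<close>

locale symmetric_bids = real_distribution D for D :: "real measure" +
  fixes N j :: nat and s :: real and b :: "real \<Rightarrow> real"
  assumes N: "0 < N" and j: "j \<le> N" and s: "0 < s"
    and b_nonneg: "\<And>w. 0 \<le> w \<Longrightarrow> w \<le> 1 \<Longrightarrow> 0 \<le> b w"
    and quantile: "\<And>w. 0 \<le> w \<Longrightarrow> w \<le> 1 \<Longrightarrow> measure D {..<b w} \<le> w \<and> w \<le> cdf D (b w)"
    and optimal: "\<And>w a. 0 \<le> w \<Longrightarrow> w \<le> 1 \<Longrightarrow> 0 \<le> a \<Longrightarrow>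
      interval_mean (virtual_payoff (cdf D) a (N + 2) (j + 2) (w powr s)) (measure D {..<a}) (cdf D a)
      \<le> interval_mean (virtual_payoff (cdf D) (b w) (N + 2) (j + 2) (w powr s)) (measure D {..<b w}) (cdf D (b w))"
begin

abbreviation G :: "real \<Rightarrow> real" where "G \<equiv> cdf D"
abbreviation L :: "real \<Rightarrow> real" where "L a \<equiv> measure D {..<a}"
abbreviation u :: "real \<Rightarrow> real \<Rightarrow> real \<Rightarrow> real" where
  "u Z x w \<equiv> x * w ^ Suc N - tail_price G Z (Suc N) (Suc j) w"
abbreviation payoff :: "real \<Rightarrow> real \<Rightarrow> real" where
  "payoff x a \<equiv> interval_mean (u a x) (L a) (G a)"

lemma payoff_le: "0 \<le> w \<Longrightarrow> w \<le> 1 \<Longrightarrow> 0 \<le> a \<Longrightarrow> payoff (w powr s) a \<le> payoff (w powr s) (b w)"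
  using optimal[of w a] by (simp add: virtual_payoff_def[abs_def] del: power_Suc)

lemma G_mono: "mono G"
  by (simp add: mono_def cdf_nondecreasing)

lemma continuous_u: "0 \<le> l \<Longrightarrow> continuous_on {l..g} (u Z x)"
  by (intro continuous_intros continuous_on_subset[OF continuous_on_tail_price[OF G_mono cdf_nonneg, of g]]) auto

lemma payoff_eq: 
  assumes "0 \<le> a" "a \<le> Z"
  shows "payoff x a = interval_mean (u Z x) (L a) (G a)"
  by (rule interval_mean_cong[OF lessThan_le_cdf])
     (simp add: tail_price_cong_bound[OF G_mono cdf_nonneg _ assms])

text \<open>If \<open>a\<close> is an atom, no bid need realise the quantile \<open>L a\<close>
  exactly, but bids just below \<open>a\<close> approach it, and the payoff is continuous in the
  quantile.\<close>

lemma lower_deviation: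
  assumes a: "0 < a" "a \<le> Z" and w: "0 \<le> w" "w \<le> 1"
  shows "u Z (w powr s) (L a) \<le> payoff (w powr s) (b w)"
proof (rule field_le_epsilon)
  let ?u = "u Z (w powr s)"
  fix e :: real assume e: "0 < e"
  have "continuous_on {0..L a} ?u" by (rule continuous_u) simp
  then obtain d where d: "d > 0" "\<And>v. v \<in> {0..L a} \<Longrightarrow> dist v (L a) < d \<Longrightarrow> dist (?u v) (?u (L a)) < e"
    using e unfolding continuous_on_iff by (metis atLeastAtMost_iff measure_nonneg order_refl)
  have "\<forall>\<^sub>F c in at_left a. L a - d < G c"
    by (rule order_tendstoD(1)[OF cdf_at_left]) (use d in simp)
  then obtain c0 where c0: "c0 < a" "\<And>c. c0 < c \<Longrightarrow> c < a \<Longrightarrow> L a - d < G c"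
    unfolding eventually_at_left_field by blast
  \<comment> \<open>Two points are needed: the limit controls \<open>G c1\<close>, while the mean
    for the bid \<open>c2\<close> starts at \<open>L c2\<close>, which is at least
    \<open>G c1\<close>.\<close>
  obtain c1 where c1: "max c0 0 < c1" "c1 < a" using dense[of "max c0 0" a] c0 a by auto
  obtain c2 where c2: "c1 < c2" "c2 < a" using dense[of c1 a] c1 by auto
  have "?u (L a) - e \<le> interval_mean ?u (L c2) (G c2)"
  proof (rule interval_mean_ge[OF lessThan_le_cdf continuous_u])
    fix v assume v: "L c2 \<le> v" "v \<le> G c2"
    have "L a - d < v" using c0(2)[of c1] c1 cdf_le_lessThan[OF c2(1)] v by simp
    moreover have "v \<le> L a" using cdf_le_lessThan[OF c2(2)] v by simp
    ultimately have "dist (?u v) (?u (L a)) < e"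
      using v order_trans[OF measure_nonneg v(1)] by (intro d(2)) (auto simp: dist_real_def)
    then show "?u (L a) - e \<le> ?u v" by (simp add: dist_real_def abs_less_iff del: power_Suc)
  qed simp
  also have "\<dots> = payoff (w powr s) c2"
    using c1 c2 a by (intro payoff_eq[symmetric]) auto
  also have "\<dots> \<le> payoff (w powr s) (b w)"
    using c1 c2 w by (intro payoff_le) auto
  finally show "?u (L a) \<le> payoff (w powr s) (b w) + e" by simp
qed

text \<open>Here right-continuity of \<open>G\<close> lets bids just above \<open>a\<close> approach
  the quantile \<open>G a\<close>; \<open>a < Z\<close> leaves room for them below the
  cut-off.\<close>

lemma upper_deviation:
  assumes a: "0 \<le> a" "a < Z" and w: "0 \<le> w" "w \<le> 1"
  shows "u Z (w powr s) (G a) \<le> payoff (w powr s) (b w)"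
proof (rule field_le_epsilon)
  let ?u = "u Z (w powr s)"
  fix e :: real assume e: "0 < e"
  have "continuous_on {0..G Z} ?u" by (rule continuous_u) simp
  moreover have "G a \<in> {0..G Z}" using a by (auto simp: cdf_nonneg cdf_nondecreasing)
  ultimately obtain d where d: "d > 0" "\<And>v. v \<in> {0..G Z} \<Longrightarrow> dist v (G a) < d \<Longrightarrow> dist (?u v) (?u (G a)) < e"
    using e unfolding continuous_on_iff by metis
  have "\<forall>\<^sub>F c in at_right a. G c < G a + d"
    by (rule order_tendstoD(2)[OF cdf_is_right_cont[unfolded continuous_within]]) (use d in simp)
  then obtain c0 where c0: "c0 > a" "\<And>c. a < c \<Longrightarrow> c < c0 \<Longrightarrow> G c < G a + d"
    unfolding eventually_at_right_field by blast
  obtain c where c: "a < c" "c < min c0 Z" using dense[of a "min c0 Z"] c0 a by auto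
  have "?u (G a) - e \<le> interval_mean ?u (L c) (G c)"
  proof (rule interval_mean_ge[OF lessThan_le_cdf continuous_u])
    fix v assume v: "L c \<le> v" "v \<le> G c"
    have "v < G a + d" using c0(2)[of c] c v by simp
    moreover have "G a \<le> v" using cdf_le_lessThan[OF c(1)] v by simp
    moreover have "G c \<le> G Z" using c by (simp add: cdf_nondecreasing)
    ultimately have "dist (?u v) (?u (G a)) < e"
      using v order_trans[OF measure_nonneg v(1)] by (intro d(2)) (auto simp: dist_real_def)
    then show "?u (G a) - e \<le> ?u v" by (simp add: dist_real_def abs_less_iff del: power_Suc)
  qed simp
  also have "\<dots> = payoff (w powr s) c"
    using c a by (intro payoff_eq[symmetric]) auto
  also have "\<dots> \<le> payoff (w powr s) (b w)"
    using c a w by (intro payoff_le) auto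
  finally show "?u (G a) \<le> payoff (w powr s) (b w) + e" by simp
qed

end

section \<open>The bid distribution has no atoms\<close>

context symmetric_bids
begin

lemma power_diff_pos: "0 \<le> v \<Longrightarrow> v < w \<Longrightarrow> 0 < w ^ Suc N - v ^ Suc N" for v w :: real
  using power_strict_mono[of v w "Suc N"] by (simp del: power_Suc)

text \<open>By \<open>tail_price_diff\<close>, \<open>u Z x\<close> has density
  \<open>Suc N * (x * z ^ N - tail_price G Z N j z)\<close>; the gap between \<open>y\<close> and
  \<open>x\<close> makes the increase strict.\<close>

lemma u_less:
  assumes "0 \<le> v" "v < w" "y < x" "\<And>z. v < z \<Longrightarrow> z < w \<Longrightarrow> tail_price G Z N j z \<le> y * z ^ N"
  shows "u Z x v < u Z x w"
proof -
  have "tail_price G Z (Suc N) (Suc j) w - tail_price G Z (Suc N) (Suc j) v \<le> y * (w ^ Suc N - v ^ Suc N)"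
    by (rule tail_price_diff_le[OF G_mono cdf_nonneg]) (use assms in auto)
  also have "\<dots> < x * (w ^ Suc N - v ^ Suc N)"
    using assms power_diff_pos[of v w] by (intro mult_strict_right_mono) auto
  finally show ?thesis by (simp add: right_diff_distrib del: power_Suc)
qed

lemma u_antimono:
  assumes "0 \<le> v" "v \<le> w" "\<And>z. v < z \<Longrightarrow> z < w \<Longrightarrow> x * z ^ N \<le> tail_price G Z N j z"
  shows "u Z x w \<le> u Z x v"
  using tail_price_diff_ge[OF G_mono cdf_nonneg assms] by (simp add: right_diff_distrib del: power_Suc)

lemma u_greater:
  assumes "0 \<le> v" "v < w" "x < y" "\<And>z. v < z \<Longrightarrow> z < w \<Longrightarrow> y * z ^ N \<le> tail_price G Z N j z"
  shows "u Z x w < u Z x v"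
proof -
  have "x * (w ^ Suc N - v ^ Suc N) < y * (w ^ Suc N - v ^ Suc N)"
    using assms power_diff_pos[of v w] by (intro mult_strict_right_mono) auto
  also have "\<dots> \<le> tail_price G Z (Suc N) (Suc j) w - tail_price G Z (Suc N) (Suc j) v"
    by (rule tail_price_diff_ge[OF G_mono cdf_nonneg]) (use assms in auto)
  finally show ?thesis by (simp add: right_diff_distrib del: power_Suc)
qed

lemma tail_price_ratio_le:
  assumes "0 < v" "v \<le> w" "y * v ^ N \<le> tail_price G Z N j v"
  shows "y * w ^ N \<le> tail_price G Z N j w"
proof -
  have "y \<le> tail_price G Z N j v / v ^ N" using assms by (simp add: field_simps)
  also have "\<dots> \<le> tail_price G Z N j w / w ^ N"
    using assms by (intro tail_price_ratio_mono[OF G_mono cdf_nonneg _ _ N]) auto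
  finally show ?thesis using assms by (simp add: field_simps)
qed

lemma bid_eq_atom:
  assumes "L a < w" "w < G a" "0 \<le> w" "w \<le> 1"
  shows "b w = a"
proof (rule ccontr)
  assume "b w \<noteq> a"
  then consider "b w < a" | "a < b w" by linarith
  then show False
    using cdf_le_lessThan[of "b w" a] cdf_le_lessThan[of a "b w"] quantile[of w] assms by cases auto
qed

text \<open>Otherwise types just below the atom would rather bid just below \<open>a\<close> than what they bid.\<close>

lemma price_at_bottom_of_atom:
  assumes q: "0 < L a" and Z: "a \<le> Z"
  shows "L a powr s * L a ^ N \<le> tail_price G Z N j (L a)"
proof (rule ccontr)
  define q where "q = L a"
  assume "\<not> ?thesis"
  then have m: "tail_price G Z N j q < q powr s * q ^ N" by (simp add: q_def)
  define m where "m = tail_price G Z N j q / q ^ N"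
  have q0: "0 < q" and q1: "q \<le> 1" using q by (simp_all add: q_def)
  have mq: "m < q powr s" "0 \<le> m"
    using m q0 tail_price_nonneg[OF G_mono cdf_nonneg] by (simp_all add: m_def field_simps)
  \<comment> \<open>A type \<open>y\<close> strictly between the conditional price \<open>m\<close>
    at \<open>q\<close> and the type at \<open>q\<close> has a quantile \<open>w < q\<close>. Its
    payoff still rises strictly up to \<open>q\<close>, so its own bid, which is below
    \<open>a\<close>, is beaten by bids approaching the quantile \<open>q\<close>.\<close>
  obtain y where y: "m < y" "y < q powr s" using dense mq by blast
  define w where "w = y powr (1 / s)"
  have w: "w powr s = y" "0 \<le> w" "w < q"
  proof -
    show ws: "w powr s = y" using y mq s by (simp add: w_def powr_powr)
    show "0 \<le> w" by (simp add: w_def)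
    show "w < q"
      using y(2) powr_mono2[of s q w] q0 s ws by (cases "w < q") auto
  qed
  have w1: "w \<le> 1" using w q1 by simp
  have bw: "b w < a"
  proof (rule ccontr)
    assume "\<not> b w < a"
    then have "L a \<le> L (b w)" by (intro finite_measure_mono) auto
    with quantile[of w] w w1 show False by (simp add: q_def)
  qed
  have b0: "0 \<le> b w" by (rule b_nonneg[OF w(2) w1])
  have inc: "u Z y v < u Z y q" if v: "0 \<le> v" "v < q" for v
  proof (rule u_less[OF v y(1)])
    fix z assume z: "v < z" "z < q"
    then have "tail_price G Z N j z / z ^ N \<le> m"
      unfolding m_def using v by (intro tail_price_ratio_mono[OF G_mono cdf_nonneg _ _ N]) auto
    then show "tail_price G Z N j z \<le> m * z ^ N" using z v by (simp add: field_simps)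
  qed
  have G_q: "G (b w) \<le> q" unfolding q_def by (rule cdf_le_lessThan[OF bw])
  have "payoff y (b w) = interval_mean (u Z y) (L (b w)) (G (b w))"
    using bw Z b0 by (intro payoff_eq) auto
  also have "\<dots> < u Z y q"
  proof (rule interval_mean_less[OF lessThan_le_cdf continuous_u, of _ _ _ _ "L (b w)"])
    show "u Z y v \<le> u Z y q" if "L (b w) \<le> v" "v \<le> G (b w)" for v
      using inc[of v] that G_q order_trans[OF measure_nonneg that(1)] by (cases "v = q") auto
    show "u Z y (L (b w)) < u Z y q"
      using quantile[OF w(2) w1] w by (intro inc) auto
  qed (auto simp: lessThan_le_cdf)
  also have "\<dots> \<le> payoff y (b w)"
    using lower_deviation[of a Z w] b0 bw Z w w1 by (simp add: q_def)
  finally show False by simp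
qed

lemma no_atoms:
  assumes a: "0 \<le> a"
  shows "L a = G a"
proof (rule ccontr)
  assume "L a \<noteq> G a"
  \<comment> \<open>Any cut-off strictly above \<open>a\<close> leaves room for overbidding;
    \<open>a + 1\<close> is one.\<close>
  define q r Z where "q = L a" and "r = G a" and "Z = a + 1"
  have qr: "q < r" using lessThan_le_cdf[of a] \<open>L a \<noteq> G a\<close> by (simp add: q_def r_def)
  have q0: "0 \<le> q" by (simp add: q_def)
  have r1: "r \<le> 1" using cdf_bounded_prob by (simp add: r_def)
  have aZ: "a \<le> Z" "a < Z" by (simp_all add: Z_def)
  have bid: "b w = a" if "q < w" "w < r" for w
    using that q0 r1 unfolding q_def r_def by (intro bid_eq_atom) linarith+
  have pay: "payoff x a = interval_mean (u Z x) q r" for x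
    unfolding q_def r_def using a aZ by (intro payoff_eq) auto
  obtain w1 where w1: "q < w1" "w1 < r" using dense qr by blast
  obtain w2 where w2: "w1 < w2" "w2 < r" using dense w1 by blast
  have tau: "w1 powr s < w2 powr s" "q powr s < w1 powr s"
    using w1 w2 q0 s by (auto intro: powr_less_mono2)
  \<comment> \<open>Otherwise type \<open>w2\<close> would overbid the atom.\<close>
  have "\<exists>v. q < v \<and> v < r \<and> w1 powr s * v ^ N \<le> tail_price G Z N j v"
  proof (rule ccontr)
    assume "\<not> ?thesis"
    then have m: "tail_price G Z N j v \<le> w1 powr s * v ^ N" if "q < v" "v < r" for v
      using that by force
    have inc: "u Z (w2 powr s) v < u Z (w2 powr s) r" if "q \<le> v" "v < r" for v
      using that q0 tau m by (intro u_less[of v r "w1 powr s"]) auto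
    have "payoff (w2 powr s) a < u Z (w2 powr s) r"
      unfolding pay
    proof (rule interval_mean_less[of q r _ _ q])
      show "u Z (w2 powr s) v \<le> u Z (w2 powr s) r" if "q \<le> v" "v \<le> r" for v
        using inc[of v] that by (cases "v = r") auto
    qed (use qr q0 inc continuous_u in auto)
    moreover have "u Z (w2 powr s) r \<le> payoff (w2 powr s) a"
      using upper_deviation[OF a aZ(2), of w2] bid[of w2] w1 w2 q0 r1 by (simp add: r_def)
    ultimately show False by simp
  qed
  then obtain v where v: "q < v" "v < r" "w1 powr s * v ^ N \<le> tail_price G Z N j v" by blast
  \<comment> \<open>An atom at \<open>0\<close> cannot be underbid and is excluded separately: there
    the price is \<open>0\<close>, against the positive lower bound found at
    \<open>v\<close>.\<close>
  have a0: "0 < a"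
  proof (rule ccontr)
    assume "\<not> 0 < a"
    with a have "a = 0" by simp
    have "tail_price G Z N j v = tail_price G 0 N j v"
      using v aZ \<open>a = 0\<close> by (intro tail_price_cong_bound[symmetric, OF G_mono cdf_nonneg]) (auto simp: r_def)
    also have "\<dots> = 0" by (simp add: tail_price_def)
    finally have "w1 powr s * v ^ N \<le> 0" using v by simp
    moreover have "0 < w1 powr s * v ^ N" using w1 v q0 by (intro mult_pos_pos) auto
    ultimately show False by simp
  qed
  \<comment> \<open>The payoff from bidding the atom is affine in the type, with winning probability
    \<open>A\<close> and expected payment \<open>B\<close>; this makes the limit over types
    immediate.\<close>
  define A B where "A = interval_mean (\<lambda>w. w ^ Suc N) q r"
    and "B = interval_mean (tail_price G Z (Suc N) (Suc j)) q r"
  have AB: "interval_mean (u Z x) q r = x * A - B" for x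
    unfolding A_def B_def
    by (rule interval_mean_diff[OF less_imp_le[OF qr]])
       (use q0 in \<open>auto intro!: continuous_intros continuous_on_subset[OF continuous_on_tail_price[OF G_mono cdf_nonneg, of r]]\<close>)
  \<comment> \<open>The types in the atom do not underbid it; let them tend to \<open>q\<close>.\<close>
  have "u Z (q powr s) q \<le> (q powr s) * A - B"
  proof (rule tendsto_le[OF _ _ _ eventually_at_rightI[of q r]])
    have cont: "((\<lambda>w. w powr s) \<longlongrightarrow> q powr s) (at_right q)"
      by (rule tendsto_powr'[OF tendsto_ident_at tendsto_const]) (use q0 s in \<open>auto simp: eventually_at_filter\<close>)
    show "((\<lambda>w. w powr s * A - B) \<longlongrightarrow> q powr s * A - B) (at_right q)"
      "((\<lambda>w. u Z (w powr s) q) \<longlongrightarrow> u Z (q powr s) q) (at_right q)"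
      by (intro tendsto_diff tendsto_mult cont tendsto_const)+
    show "u Z (w powr s) q \<le> w powr s * A - B" if "w \<in> {q<..<r}" for w
      using lower_deviation[OF a0 aZ(1), of w] bid[of w] that q0 r1 pay[of "w powr s"] AB[of "w powr s"]
      by (simp add: q_def[symmetric] del: power_Suc)
  qed (use qr in auto)
  also have "\<dots> = interval_mean (u Z (q powr s)) q r" by (rule AB[symmetric])
  also have "\<dots> < u Z (q powr s) q"
  proof (rule interval_mean_less[of q r _ _ r])
    \<comment> \<open>The bound at \<open>q\<close> persists above \<open>q\<close> since the
      conditional price is monotone. For \<open>q = 0\<close> it is trivial, because
      \<open>0 powr s = 0\<close>.\<close>
    have m: "q powr s * z ^ N \<le> tail_price G Z N j z" if "q \<le> z" for z
    proof (cases "q = 0")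
      case True
      then show ?thesis by (simp add: tail_price_nonneg[OF G_mono cdf_nonneg])
    next
      case False
      then have "q powr s * q ^ N \<le> tail_price G Z N j q"
        using price_at_bottom_of_atom[of a Z] q0 aZ unfolding q_def by linarith
      then show ?thesis by (rule tail_price_ratio_le[rotated 2]) (use False q0 that in auto)
    qed
    show "u Z (q powr s) w \<le> u Z (q powr s) q" if "q \<le> w" for w
      using that q0 m by (intro u_antimono) auto
    note this[of v]
    moreover have "w1 powr s * z ^ N \<le> tail_price G Z N j z" if "v \<le> z" for z
      by (rule tail_price_ratio_le[of v]) (use v q0 that in auto)
    then have "u Z (q powr s) r < u Z (q powr s) v"
      using v q0 tau by (intro u_greater[of v r _ "w1 powr s"]) auto
    ultimately show "u Z (q powr s) r < u Z (q powr s) q" using v by simp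
  qed (use qr q0 continuous_u in auto)
  finally show False by simp
qed

end

subsection \<open>Solving for the equilibrium bids\<close>

text \<open>The factor \<open>i\<close> comes from differentiating \<open>w powr (N - i + s)\<close>
  and dividing by the \<open>N - i\<close> of the tail recursion.\<close>

definition bid_factor :: "nat \<Rightarrow> nat \<Rightarrow> real \<Rightarrow> real" where
  "bid_factor N j s = (\<Prod>i<j. (real (N - i) + s) / real (N - i))"

lemma bid_factor_Suc:
  "bid_factor (Suc N) (Suc j) s = (real (Suc N) + s) / real (Suc N) * bid_factor N j s"
  unfolding bid_factor_def by (subst prod.lessThan_Suc_shift) simp

lemma bid_factor_pos: "j \<le> N \<Longrightarrow> 0 < s \<Longrightarrow> 0 < bid_factor N j s"
  unfolding bid_factor_def by (intro prod_pos) (auto intro!: divide_pos_pos add_pos_pos)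

text \<open>Each step differentiates the integral identity. The density is monotone, so it equals
  the derivative at every point and not just almost everywhere. The constant \<open>c\<close> is
  general because it absorbs one factor per step.\<close>

lemma tail_price_downward:
  fixes s :: real
  assumes G: "mono G" "\<And>z. 0 \<le> G z" and "j \<le> N"
    and eq: "\<And>w. 0 < w \<Longrightarrow> w < 1 \<Longrightarrow> tail_price G Z N j w = c * w powr (N + s)"
    and w: "0 < w" "w < 1"
  shows "tail_price G Z (N - j) 0 w = c * bid_factor N j s * w powr (real (N - j) + s)"
  using assms(3) eq
proof (induction j arbitrary: N c)
  case 0
  then show ?case using w by (simp add: bid_factor_def)
next
  case (Suc j)
  then obtain N' where N: "N = Suc N'" and le: "j \<le> N'" by (cases N) auto
  define d where "d = (real (Suc N') + s) / real (Suc N')"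
  have eq: "tail_price G Z N' j v = c * d * v powr (N' + s)" if v: "0 < v" "v < 1" for v
  proof -
    have "Suc N' * tail_price G Z N' j v = c * ((real (Suc N') + s) * v powr (real (Suc N') + s - 1))"
    proof (rule integral_mono_eq_deriv[where b = 1 and h = "\<lambda>v. Suc N' * tail_price G Z N' j v"
        and H = "tail_price G Z (Suc N') (Suc j)"])
      show "((\<lambda>v. Suc N' * tail_price G Z N' j v) has_integral
        tail_price G Z (Suc N') (Suc j) y - tail_price G Z (Suc N') (Suc j) x) {x..y}"
        if "0 \<le> x" "x \<le> y" for x y
        by (rule tail_price_diff[OF G that])
      show "Suc N' * tail_price G Z N' j x \<le> Suc N' * tail_price G Z N' j y" if "x \<le> y" for x y
        by (intro mult_left_mono tail_price_mono[OF G that]) simp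
      have "((\<lambda>v. c * v powr (real (Suc N') + s)) has_real_derivative
        c * ((real (Suc N') + s) * v powr (real (Suc N') + s - 1))) (at v)"
        by (intro DERIV_cmult has_real_derivative_powr v)
      then show "(tail_price G Z (Suc N') (Suc j) has_real_derivative
        c * ((real (Suc N') + s) * v powr (real (Suc N') + s - 1))) (at v)"
        by (rule has_field_derivative_transform_within_open[of _ _ _ "{0<..<1}"])
           (use v Suc.prems(2) in \<open>auto simp: N\<close>)
    qed (use v in auto)
    then have "real (Suc N') * tail_price G Z N' j v = c * (real (Suc N') + s) * v powr (N' + s)" by simp
    then show ?thesis by (simp add: d_def field_simps)
  qed
  show ?case
    using Suc.IH[OF le eq] unfolding N bid_factor_Suc d_def[symmetric] by (simp add: mult_ac)
qed

context symmetric_bids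
begin

lemma G_bid: "0 \<le> w \<Longrightarrow> w \<le> 1 \<Longrightarrow> G (b w) = w"
  using no_atoms[of "b w"] b_nonneg[of w] quantile[of w] by auto

lemma bid_less_iff:
  assumes "0 \<le> w" "w \<le> 1" "0 \<le> z"
  shows "G z < w \<Longrightarrow> z < b w" "w < G z \<Longrightarrow> b w < z"
proof -
  show "z < b w" if "G z < w"
    using cdf_nondecreasing[of "b w" z] G_bid[OF assms(1,2)] that by (cases "z < b w") auto
  show "b w < z" if "w < G z"
    using cdf_nondecreasing[of z "b w"] G_bid[OF assms(1,2)] that by (cases "b w < z") auto
qed

lemma bid_strict_mono: "0 \<le> w \<Longrightarrow> w < w' \<Longrightarrow> w' \<le> 1 \<Longrightarrow> b w < b w'"
  using bid_less_iff(2)[of w "b w'"] G_bid[of w'] b_nonneg[of w'] by simp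

lemma bid_le_top: "0 \<le> w \<Longrightarrow> w \<le> 1 \<Longrightarrow> b w \<le> b 1"
  using bid_strict_mono[of w 1] by (cases "w = 1") auto

text \<open>Incentive compatibility for imitating other types only: type \<open>w\<close> does not
  gain from the bid of type \<open>w'\<close>. Both orders of \<open>w\<close> and \<open>w'\<close>
  are allowed, which yields bounds from both sides.\<close>

lemma tail_price_increment:
  assumes "0 \<le> w" "w \<le> 1" "0 \<le> w'" "w' \<le> 1"
  shows "w powr s * (w' ^ Suc N - w ^ Suc N)
    \<le> tail_price G (b 1) (Suc N) (Suc j) w' - tail_price G (b 1) (Suc N) (Suc j) w"
proof -
  have p: "payoff x (b v) = u (b 1) x v" if "0 \<le> v" "v \<le> 1" for x v
  proof -
    have "payoff x (b v) = interval_mean (u (b 1) x) (L (b v)) (G (b v))"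
      using that by (intro payoff_eq b_nonneg bid_le_top)
    then show ?thesis using no_atoms[of "b v"] that b_nonneg[of v] G_bid[of v] by simp
  qed
  have "u (b 1) (w powr s) w' \<le> u (b 1) (w powr s) w"
    using payoff_le[of w "b w'"] assms b_nonneg[of w'] p by simp
  then show ?thesis by (simp add: right_diff_distrib del: power_Suc)
qed

text \<open>The first-order condition without differentiability: if the price at \<open>w\<close>
  were too low, some type \<open>v < w\<close> would gain from imitating \<open>w\<close>; if too
  high, some type \<open>v > w\<close> would. Continuity of \<open>v powr s * v ^ N\<close> closes
  the gap.\<close>

lemma tail_price_eq_powr:
  assumes w: "0 < w" "w < 1"
  shows "tail_price G (b 1) N j w = w powr (N + s)"
proof -
  let ?K = "tail_price G (b 1) N j" and ?h = "\<lambda>v. v powr s * v ^ N"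
  have lower: "?h v \<le> ?K w" if v: "0 < v" "v < w" for v
  proof (rule ccontr)
    assume "\<not> ?thesis"
    \<comment> \<open>As \<open>?K\<close> is monotone, the constant \<open>?K w / v ^ N\<close>
      bounds the conditional price throughout the interval from \<open>v\<close> to
      \<open>w\<close>.\<close>
    then have "?K w / v ^ N < v powr s" using v by (simp add: field_simps)
    moreover have "?K z \<le> ?K w / v ^ N * z ^ N" if z: "v < z" "z < w" for z
    proof -
      have "?K z \<le> ?K w / v ^ N * v ^ N"
        using tail_price_mono[OF G_mono cdf_nonneg, of z w] v z by simp
      also have "\<dots> \<le> ?K w / v ^ N * z ^ N"
        using v z by (intro mult_left_mono power_mono divide_nonneg_nonneg tail_price_nonneg[OF G_mono cdf_nonneg]) auto
      finally show ?thesis .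
    qed
    ultimately have "u (b 1) (v powr s) v < u (b 1) (v powr s) w"
      using v by (intro u_less) auto
    with tail_price_increment[of v w] v w show False by (simp add: right_diff_distrib del: power_Suc)
  qed
  have upper: "?K w \<le> ?h v" if v: "w < v" "v < 1" for v
  proof (rule ccontr)
    assume "\<not> ?thesis"
    then have "v powr s < ?K w / v ^ N" using v w by (simp add: field_simps)
    moreover have "?K w / v ^ N * z ^ N \<le> ?K z" if z: "w < z" "z < v" for z
    proof -
      have "?K w / v ^ N * z ^ N \<le> ?K w / v ^ N * v ^ N"
        using w v z by (intro mult_left_mono power_mono divide_nonneg_nonneg tail_price_nonneg[OF G_mono cdf_nonneg]) auto
      also have "\<dots> \<le> ?K z"
        using tail_price_mono[OF G_mono cdf_nonneg, of w z] w v z by simp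
      finally show ?thesis .
    qed
    ultimately have "u (b 1) (v powr s) v < u (b 1) (v powr s) w"
      using v w by (intro u_greater) auto
    with tail_price_increment[of v w] v w show False by (simp add: right_diff_distrib del: power_Suc)
  qed
  have lim: "(?h \<longlongrightarrow> ?h w) (at w within S)" for S
    by (intro tendsto_intros) (use w in auto)
  have "?h w \<le> ?K w"
    by (rule tendsto_upperbound[OF lim[of "{..<w}"] eventually_at_leftI[of 0 w]]) (use lower w in auto)
  moreover have "?K w \<le> ?h w"
    by (rule tendsto_lowerbound[OF lim[of "{w<..}"] eventually_at_rightI[of w 1]]) (use upper w in auto)
  ultimately show ?thesis using w by (simp add: powr_add powr_realpow mult.commute)
qed

text \<open>\<open>?Q\<close> is the quantile function of the bids. As \<open>G (b w) = w\<close>,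
  the bid \<open>b w\<close> lies between \<open>?Q w\<close> and \<open>?Q v\<close> for every
  \<open>v > w\<close>, and \<open>?Q\<close> turns out to be continuous.\<close>

lemma bid_eq:
  assumes w: "0 \<le> w" "w < 1"
  shows "b w = bid_factor N j s * w powr s"
proof -
  let ?Q = "tail_price G (b 1) 0 0" and ?c = "bid_factor N j s"
  have Q: "?Q v = ?c * v powr s" if v: "0 < v" "v < 1" for v
  proof -
    have "tail_price G (b 1) (N - j) 0 v = ?c * v powr (real (N - j) + s)"
      using tail_price_downward[OF G_mono cdf_nonneg j, of "b 1" 1 s v] tail_price_eq_powr v by simp
    then show ?thesis
      using v tail_price_0[OF G_mono cdf_nonneg, of "b 1" "N - j" v]
      by (simp add: powr_add powr_realpow)
  qed
  have int: "(\<lambda>z. of_bool (z < p) :: real) integrable_on {0..b 1}" for p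
    by (rule bounded_borel_integrable_on_Icc[of _ _ _ 1]) (auto simp: of_bool_def)
  have lower: "?Q v \<le> b v" if v: "0 < v" "v < 1" for v
  proof -
    have "?Q v \<le> integral {0..b 1} (\<lambda>z. of_bool (z < b v))"
      unfolding tail_price_def
      by (intro integral_le tail_price_integrable[OF G_mono cdf_nonneg] int)
         (use bid_less_iff(1)[of v] v in auto)
    also have "\<dots> = b v" using v by (intro integral_less_eq b_nonneg bid_le_top) auto
    finally show ?thesis .
  qed
  have upper: "b w \<le> ?Q v" if v: "w < v" "v < 1" for v
  proof -
    have "b w = integral {0..b 1} (\<lambda>z. of_bool (z < b w))"
      using w by (intro integral_less_eq[symmetric] b_nonneg bid_le_top) auto
    also have "\<dots> \<le> ?Q v"
      unfolding tail_price_def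
    proof (intro integral_le tail_price_integrable[OF G_mono cdf_nonneg] int)
      fix z
      have "z < b w \<Longrightarrow> G z < v"
        using cdf_nondecreasing[of z "b w"] G_bid[of w] w v by simp
      then show "of_bool (z < b w) \<le> (if G z < v then binomial_tail 0 0 v (G z) else 0)" by auto
    qed
    finally show ?thesis .
  qed
  have "b w \<le> ?c * w powr s"
  proof (rule tendsto_lowerbound[OF _ eventually_at_rightI[of w 1]])
    show "((\<lambda>v. ?c * v powr s) \<longlongrightarrow> ?c * w powr s) (at_right w)"
      by (intro tendsto_mult tendsto_const tendsto_powr'[OF tendsto_ident_at tendsto_const])
         (use w s in \<open>auto simp: eventually_at_filter\<close>)
    show "b w \<le> ?c * v powr s" if "v \<in> {w<..<1}" for v
      using upper[of v] Q[of v] that w by simp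
  qed (use w in auto)
  \<comment> \<open>At \<open>w = 0\<close> the left side is \<open>0\<close>, and nonnegativity of
    bids suffices.\<close>
  moreover have "?c * w powr s \<le> b w"
    using lower[of w] Q[of w] w b_nonneg[of 0] by (cases "w = 0") auto
  ultimately show ?thesis by simp
qed

end

lemma auction_payoff_cong:
  assumes "i < n" "\<And>j. j < n \<Longrightarrow> b j = b' j"
  shows "auction_payoff n k i x b = auction_payoff n k i x b'"
proof -
  have "map b [0..<n] = map b' [0..<n]" using assms by simp
  then have "kth_highest_bid n k b = kth_highest_bid n k b'" by (simp only: kth_highest_bid_def)
  moreover have "highest_bidders n b = highest_bidders n b'"
    using assms by (auto simp: highest_bidders_def)
  ultimately show ?thesis by (simp add: auction_payoff_def)
qed

section \<open>Winning probabilities and null sets of bids\<close>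

context real_distribution
begin

text \<open>\<open>S\<close> may be uncountable and nonmeasurable. A point of \<open>S\<close> that
  is neither largest nor smallest lies in a null interval with rational endpoints, of which there
  are countably many; a largest or smallest point is a null singleton.\<close>

lemma pairwise_null_imp_null:
  assumes "\<And>p q. p \<in> S \<Longrightarrow> q \<in> S \<Longrightarrow> p \<le> q \<Longrightarrow> {p..q} \<in> null_sets M"
  obtains T where "T \<in> null_sets M" "S \<subseteq> T"
proof -
  define R where "R = {(r, r'). r \<in> \<rat> \<and> r' \<in> \<rat> \<and> {r..r'} \<in> null_sets M}"
  define A where "A = {p\<in>S. \<forall>q\<in>S. q \<le> p}"
  define B where "B = {p\<in>S. \<forall>q\<in>S. p \<le> q}"
  have extreme: "C \<in> null_sets M" if "C \<subseteq> S" "\<And>p q. p \<in> C \<Longrightarrow> q \<in> C \<Longrightarrow> p = q" for C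
  proof (cases "C = {}")
    case False
    then obtain p where "p \<in> C" by blast
    with that have "C = {p..p}" "p \<in> S" by auto
    with assms[of p p] show ?thesis by simp
  qed simp
  have "R \<subseteq> \<rat> \<times> \<rat>" by (auto simp: R_def)
  then have "countable R" by (rule countable_subset) (simp add: countable_rat)
  then have "(\<Union>(r, r')\<in>R. {r..r'}) \<in> null_sets M"
    by (intro null_sets_UN') (auto simp: R_def)
  moreover have "A \<in> null_sets M" by (rule extreme) (auto simp: A_def intro: antisym)
  moreover have "B \<in> null_sets M" by (rule extreme) (auto simp: B_def intro: antisym)
  ultimately have "(\<Union>(r, r')\<in>R. {r..r'}) \<union> A \<union> B \<in> null_sets M"
    by (intro null_sets.Un)
  moreover have "S \<subseteq> (\<Union>(r, r')\<in>R. {r..r'}) \<union> A \<union> B"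
  proof
    fix p assume p: "p \<in> S"
    show "p \<in> (\<Union>(r, r')\<in>R. {r..r'}) \<union> A \<union> B"
    proof (cases "p \<in> A \<union> B")
      case False
      with p obtain q q' where q: "q \<in> S" "q < p" and q': "q' \<in> S" "p < q'"
        by (auto simp: A_def B_def not_le)
      obtain r where r: "r \<in> \<rat>" "q < r" "r < p" using Rats_dense_in_real[OF q(2)] by blast
      obtain r' where r': "r' \<in> \<rat>" "p < r'" "r' < q'" using Rats_dense_in_real[OF q'(2)] by blast
      have "{r..r'} \<in> null_sets M"
        by (rule null_sets_subset[OF assms[OF q(1) q'(1)]]) (use r r' q q' in auto)
      then have "(r, r') \<in> R" using r r' by (simp add: R_def)
      moreover have "p \<in> {r..r'}" using r r' by simp
      ultimately show ?thesis by blast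
    qed auto
  qed
  ultimately show ?thesis by (rule that)
qed

definition winning_prob :: "nat \<Rightarrow> real \<Rightarrow> real" where
  "winning_prob N a = interval_mean (\<lambda>w. w ^ N) (measure M {..<a}) (cdf M a)"

lemma winning_prob_bounds:
  "winning_prob N a \<le> cdf M a ^ N" "measure M {..<a} ^ N \<le> winning_prob N a"
  unfolding winning_prob_def
  by (rule interval_mean_le interval_mean_ge;
      auto intro!: continuous_intros power_mono lessThan_le_cdf intro: order_trans[OF measure_nonneg])+

lemma winning_prob_strict_bounds:
  assumes "0 < N" "measure M {..<a} < cdf M a"
  shows "winning_prob N a < cdf M a ^ N" "measure M {..<a} ^ N < winning_prob N a"
proof -
  show "winning_prob N a < cdf M a ^ N"
    unfolding winning_prob_def
    by (rule interval_mean_less[OF less_imp_le[OF assms(2)], where w = "measure M {..<a}"])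
       (use assms in \<open>auto intro!: continuous_intros power_mono power_strict_mono intro: order_trans[OF measure_nonneg]\<close>)
  have "interval_mean (\<lambda>w. - (w ^ N)) (measure M {..<a}) (cdf M a) < - (measure M {..<a} ^ N)"
    by (rule interval_mean_less[OF less_imp_le[OF assms(2)], where w = "cdf M a"])
       (use assms in \<open>auto intro!: continuous_intros power_mono power_strict_mono\<close>)
  then show "measure M {..<a} ^ N < winning_prob N a"
    by (simp add: winning_prob_def interval_mean_def)
qed

lemma winning_prob_mono: "a < c \<Longrightarrow> winning_prob N a \<le> winning_prob N c"
  using winning_prob_bounds(1)[of N a] winning_prob_bounds(2)[where N = N and a = c]
    power_mono[OF cdf_le_lessThan[of a c] cdf_nonneg, of N] by linarith

text \<open>The winning probabilities at \<open>a\<close> and \<open>c\<close> are separated by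
  \<open>cdf M a ^ N\<close> and \<open>measure M {..<c} ^ N\<close>. Equality collapses the chain,
  which excludes atoms at both ends and mass between them.\<close>

lemma winning_prob_eq_imp_null:
  assumes "0 < N" "a < c" "winning_prob N a = winning_prob N c"
  shows "{a..c} \<in> null_sets M"
proof -
  have le: "cdf M a ^ N \<le> measure M {..<c} ^ N"
    by (intro power_mono cdf_le_lessThan assms cdf_nonneg)
  note bounds = winning_prob_bounds(1)[of N a] winning_prob_bounds(2)[where N = N and a = c]
  have "\<not> measure M {..<a} < cdf M a"
    using winning_prob_strict_bounds(1)[OF assms(1)] le bounds assms(3) by force
  moreover have "\<not> measure M {..<c} < cdf M c"
    using winning_prob_strict_bounds(2)[OF assms(1)] le bounds assms(3) by force
  moreover have "cdf M a = measure M {..<c}"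
  proof (rule antisym[OF cdf_le_lessThan[OF assms(2)]])
    have "measure M {..<c} ^ N \<le> cdf M a ^ N" using bounds assms(3) by linarith
    then show "measure M {..<c} \<le> cdf M a" using assms(1) by (simp add: cdf_nonneg)
  qed
  ultimately have "cdf M c - measure M {..<a} = 0"
    using lessThan_le_cdf[of a] lessThan_le_cdf[of c] by linarith
  moreover have "measure M ({..c} - {..<a}) = measure M {..c} - measure M {..<a}"
    using assms(2) by (intro finite_measure_Diff) auto
  moreover have "{..c} - {..<a} = {a..c}" by auto
  ultimately show ?thesis
    by (intro null_setsI) (auto simp: emeasure_eq_measure cdf_def)
qed

text \<open>The point \<open>a\<close> is exempt, since it may be an atom when it is alone on its
  level.\<close>

lemma winning_prob_level_null:
  assumes "0 < N"
  obtains T where "T \<in> null_sets M" "\<And>c. c \<noteq> a \<Longrightarrow> winning_prob N c = winning_prob N a \<Longrightarrow> c \<in> T"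
proof -
  have null: "{p..q} \<in> null_sets M"
    if "p \<in> {c. c \<noteq> a \<and> winning_prob N c = winning_prob N a}"
      "q \<in> {c. c \<noteq> a \<and> winning_prob N c = winning_prob N a}" "p \<le> q" for p q
  proof (cases "p = q")
    case True
    have "{min p a..max p a} \<in> null_sets M"
      using that(1) by (cases "p < a") (auto intro!: winning_prob_eq_imp_null assms)
    then show ?thesis
      by (rule null_sets_subset) (use True in auto)
  next
    case False
    with that show ?thesis by (intro winning_prob_eq_imp_null[OF assms]) auto
  qed
  obtain T where T: "T \<in> null_sets M" "{c. c \<noteq> a \<and> winning_prob N c = winning_prob N a} \<subseteq> T"
    by (rule pairwise_null_imp_null[OF null])
  show ?thesis by (rule that[OF T(1)]) (use T(2) in auto)
qed

end

section \<open>Integrating back from the quantile function\<close>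

text \<open>The converse of \<open>tail_price_downward\<close>, by integrating powers from
  \<open>0\<close>. When \<open>c\<close> is \<open>bid_factor N j s\<close>, the factors cancel and
  the conditional price at \<open>w\<close> is the type \<open>w powr s\<close>.\<close>

lemma tail_price_upward:
  fixes s :: real
  assumes G: "mono G" "\<And>z. 0 \<le> G z" and s: "0 < s" and "j \<le> N"
    and eq: "\<And>w. 0 \<le> w \<Longrightarrow> w \<le> 1 \<Longrightarrow> tail_price G Z 0 0 w = c * w powr s"
    and w: "0 \<le> w" "w \<le> 1"
  shows "bid_factor N j s * tail_price G Z N j w = c * w powr (N + s)"
  using assms(4) w
proof (induction j arbitrary: N w)
  case 0
  then show ?case
    using tail_price_0[OF G, of Z N w] s
    by (cases "w = 0") (auto simp: bid_factor_def eq powr_add powr_realpow)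
next
  case (Suc j)
  then obtain N' where N: "N = Suc N'" and le: "j \<le> N'" by (cases N) auto
  have pos: "0 < bid_factor N' j s" by (rule bid_factor_pos[OF le s])
  have "((\<lambda>v. c / bid_factor N' j s * v powr (N' + s)) has_integral
    c / bid_factor N' j s * (w powr (N' + s + 1) / (N' + s + 1))) {0..w}"
    by (intro has_integral_mult_right has_integral_powr_from_0) (use s Suc.prems in auto)
  then have "(tail_price G Z N' j has_integral
    c / bid_factor N' j s * (w powr (N' + s + 1) / (N' + s + 1))) {0..w}"
  proof (rule has_integral_eq[rotated])
    fix v assume "v \<in> {0..w}"
    then show "c / bid_factor N' j s * v powr (N' + s) = tail_price G Z N' j v"
      using Suc.IH[OF le, of v] Suc.prems pos by (simp add: field_simps)
  qed
  then have I: "integral {0..w} (tail_price G Z N' j)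
    = c / bid_factor N' j s * (w powr (N' + s + 1) / (N' + s + 1))"
    by (rule integral_unique)
  have e: "real (Suc N') + s = N' + s + 1" by simp
  have "0 < N' + s + 1" using s by (intro add_nonneg_pos add_nonneg_nonneg) auto
  moreover have "E / S * P * (S * (c / P * (W / E))) = c * W" if "0 < E" "0 < S" "0 < P" for E S P W :: real
    using that by simp
  ultimately show ?case
    unfolding N bid_factor_Suc e tail_price_Suc[OF G Suc.prems(2)] I using pos by simp
qed

subsection \<open>The auction\<close>

locale power_law_auction = prob_space M for M :: "'w measure" +
  fixes X :: "nat \<Rightarrow> 'w \<Rightarrow> real" and n k :: nat and \<alpha> :: real
  assumes k: "2 \<le> k" "k < n" and \<alpha>: "0 < \<alpha>"
    and indep: "indep_vars (\<lambda>_. borel) X {..<n}"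
    and X_range: "\<And>i \<omega>. i < n \<Longrightarrow> \<omega> \<in> space M \<Longrightarrow> X i \<omega> \<in> {0..1}"
    and cdf_X: "\<And>i x. i < n \<Longrightarrow> x \<in> {0..1} \<Longrightarrow> cdf (distr M borel (X i)) x = x powr \<alpha>"
begin

lemma n_pos: "0 < n" using k by simp

lemma X_measurable: "i < n \<Longrightarrow> X i \<in> borel_measurable M"
  using indep by (auto simp: indep_vars_def)

lemma prob_X_le: "i < n \<Longrightarrow> x \<in> {0..1} \<Longrightarrow> prob {\<omega> \<in> space M. X i \<omega> \<le> x} = x powr \<alpha>"
  using cdf_X[of i x] X_measurable[of i]
  by (simp add: cdf_def measure_distr vimage_def Int_def conj_commute)

text \<open>The distribution function is prescribed only on \<open>{0..1}\<close>; elsewhere the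
  range of the valuations determines it.\<close>

lemma distr_X_eq:
  assumes "i < n"
  shows "distr M borel (X i) = distr M borel (X 0)"
proof (rule cdf_unique)
  note meas = X_measurable[OF assms] X_measurable[OF n_pos]
  show "real_distribution (distr M borel (X i))" "real_distribution (distr M borel (X 0))"
    by (intro real_distribution_distr meas)+
  show "cdf (distr M borel (X i)) = cdf (distr M borel (X 0))"
  proof
    fix x :: real
    have out: "cdf (distr M borel (X j)) x = of_bool (1 < x)" if "x \<notin> {0..1}" "j < n" for j
    proof -
      have "{\<omega> \<in> space M. X j \<omega> \<le> x} = (if 1 < x then space M else {})"
        using X_range[OF that(2)] that(1) by force
      then show ?thesis
        using X_measurable[OF that(2)] prob_space
        by (simp add: cdf_def measure_distr vimage_def Int_def conj_commute)
    qed
    show "cdf (distr M borel (X i)) x = cdf (distr M borel (X 0)) x"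
      using out[of i] out[of 0] cdf_X[of i x] cdf_X[of 0 x] assms n_pos
      by (cases "x \<in> {0..1}") auto
  qed
qed

lemma prob_X_le_0: "x \<in> {0..1} \<Longrightarrow> prob {\<omega> \<in> space M. X 0 \<omega> \<le> x} = x powr \<alpha>"
  by (rule prob_X_le[OF n_pos])

text \<open>A strategy is Borel only on \<open>{0..1}\<close>. Extending it by \<open>0\<close>
  gives a Borel function on the line and leaves the actual bids unchanged.\<close>

definition bid :: "(real \<Rightarrow> real) \<Rightarrow> nat \<Rightarrow> 'w \<Rightarrow> real" where
  "bid \<beta> i \<omega> = (if X i \<omega> \<in> {0..1} then \<beta> (X i \<omega>) else 0)"

definition bid_distr :: "(real \<Rightarrow> real) \<Rightarrow> real measure" where
  "bid_distr \<beta> = distr M borel (bid \<beta> 0)"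

lemma bid_eq_strategy: "i < n \<Longrightarrow> \<omega> \<in> space M \<Longrightarrow> bid \<beta> i \<omega> = \<beta> (X i \<omega>)"
  using X_range[of i \<omega>] by (simp add: bid_def)

context
  fixes \<beta> :: "real \<Rightarrow> real"
  assumes \<beta>: "bidding_strategy \<beta>"
begin

lemma extended_strategy_measurable: "(\<lambda>x. if x \<in> {0..1} then \<beta> x else 0) \<in> borel_measurable borel"
  using \<beta> unfolding bidding_strategy_def by (subst (asm) measurable_restrict_space_iff[where c = 0]) auto

lemma bid_measurable: "i < n \<Longrightarrow> bid \<beta> i \<in> borel_measurable M"
  unfolding bid_def[abs_def] by (rule measurable_compose[OF X_measurable extended_strategy_measurable])

lemma bid_nonneg: "0 \<le> bid \<beta> i \<omega>"
  using \<beta> by (auto simp: bid_def bidding_strategy_def)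

lemma distr_bid:
  assumes "i < n"
  shows "distr M borel (bid \<beta> i) = bid_distr \<beta>"
proof -
  have "distr M borel (bid \<beta> j) = distr (distr M borel (X j)) borel (\<lambda>x. if x \<in> {0..1} then \<beta> x else 0)"
    if "j < n" for j
    by (subst distr_distr[OF extended_strategy_measurable])
       (use that X_measurable in \<open>auto simp: bid_def[abs_def] comp_def\<close>)
  from this[OF assms] this[OF n_pos] show ?thesis
    by (simp add: bid_distr_def distr_X_eq[OF assms])
qed

lemma real_distribution_bid: "real_distribution (bid_distr \<beta>)"
  unfolding bid_distr_def by (intro real_distribution_distr bid_measurable n_pos)

lemma measure_bid_distr:
  "A \<in> sets borel \<Longrightarrow> measure (bid_distr \<beta>) A = prob {\<omega> \<in> space M. \<beta> (X 0 \<omega>) \<in> A}"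
  unfolding bid_distr_def
  by (subst measure_distr[OF bid_measurable[OF n_pos]])
     (auto intro!: arg_cong[where f = prob] simp: bid_eq_strategy[OF n_pos])

lemma expected_payoff_eq:
  assumes i: "i < n" and a: "0 \<le> a"
  shows "expected_payoff M X n k \<beta> i x a = interval_mean (virtual_payoff (cdf (bid_distr \<beta>)) a n k x)
    (measure (bid_distr \<beta>) {..<a}) (cdf (bid_distr \<beta>) a)"
proof -
  have ind: "indep_vars (\<lambda>_. borel) (bid \<beta>) {..<n}"
    unfolding bid_def[abs_def]
    by (rule indep_vars_compose2[OF indep]) (rule extended_strategy_measurable)
  have "expected_payoff M X n k \<beta> i x a
    = (\<integral>\<omega>. auction_payoff n k i x (\<lambda>j. if j = i then a else bid \<beta> j \<omega>) \<partial>M)"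
    unfolding expected_payoff_def
    by (intro Bochner_Integration.integral_cong refl auction_payoff_cong[OF i]) (simp add: bid_eq_strategy)
  also have "\<dots> = interval_mean (virtual_payoff (cdf (bid_distr \<beta>)) a n k x)
    (measure (bid_distr \<beta>) {..<a}) (cdf (bid_distr \<beta>) a)"
    unfolding interval_mean_def
    by (rule expectation_auction_payoff[OF ind distr_bid bid_nonneg i]) (use k a in auto)
  finally show ?thesis .
qed

end

text \<open>Incentive compatibility orders winning probabilities by type, not the bids themselves.
  Two types can bid in the wrong order only at equal winning probability; the bids other than
  \<open>\<beta> x\<close> on the level of \<open>\<beta> x\<close> form a null set, so almost
  surely the other types bid on the correct side of \<open>\<beta> x\<close>.\<close>

lemma equilibrium_quantile:
  assumes eq: "symmetric_equilibrium M X n k \<beta>" and x: "x \<in> {0..1}"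
  shows "measure (bid_distr \<beta>) {..<\<beta> x} \<le> x powr \<alpha>" "x powr \<alpha> \<le> cdf (bid_distr \<beta>) (\<beta> x)"
proof -
  have strat: "bidding_strategy \<beta>" using eq by (simp add: symmetric_equilibrium_def)
  interpret D: real_distribution "bid_distr \<beta>" by (rule real_distribution_bid[OF strat])
  have \<beta>_nonneg: "0 \<le> \<beta> x" if "x \<in> {0..1}" for x
    using strat that by (simp add: bidding_strategy_def)
  define W where "W = D.winning_prob (n - 1)"
  define T where "T a = interval_mean (tail_price (cdf (bid_distr \<beta>)) a (n - 1) (k - 1))
    (measure (bid_distr \<beta>) {..<a}) (cdf (bid_distr \<beta>) a)" for a
  have n': "n - 1 = Suc (n - 2)" "k - 1 = Suc (k - 2)" using k by auto
  have cont: "continuous_on {measure (bid_distr \<beta>) {..<a}..cdf (bid_distr \<beta>) a}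
    (tail_price (cdf (bid_distr \<beta>)) a (n - 1) (k - 1))" for a
    unfolding n'
    by (rule continuous_on_subset[OF continuous_on_tail_price[OF monoI[of "cdf (bid_distr \<beta>)", OF D.cdf_nondecreasing] D.cdf_nonneg,
            of "cdf (bid_distr \<beta>) a"]]) auto
  have payoff: "expected_payoff M X n k \<beta> 0 y a = y * W a - T a" if "0 \<le> a" for y a
    unfolding expected_payoff_eq[OF strat n_pos that] virtual_payoff_def[abs_def] W_def T_def D.winning_prob_def
    by (rule interval_mean_diff[OF D.lessThan_le_cdf _ cont]) (intro continuous_intros)
  have W_mono: "W (\<beta> y) \<le> W (\<beta> z)" if "y \<in> {0..1}" "z \<in> {0..1}" "y < z" for y z
  proof -
    \<comment> \<open>Adding the two incentive constraints cancels the expected payments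
      \<open>T\<close>.\<close>
    have "y * W (\<beta> z) - T (\<beta> z) \<le> y * W (\<beta> y) - T (\<beta> y)" "z * W (\<beta> y) - T (\<beta> y) \<le> z * W (\<beta> z) - T (\<beta> z)"
      using eq that n_pos \<beta>_nonneg by (auto simp: symmetric_equilibrium_def payoff[symmetric])
    then have "(z - y) * W (\<beta> y) \<le> (z - y) * W (\<beta> z)" by (simp add: algebra_simps)
    with that show ?thesis by simp
  qed
  obtain S where S: "S \<in> null_sets (bid_distr \<beta>)" "\<And>c. c \<noteq> \<beta> x \<Longrightarrow> W c = W (\<beta> x) \<Longrightarrow> c \<in> S"
    using D.winning_prob_level_null[of "n - 1" "\<beta> x"] k unfolding W_def by (metis n'(1) zero_less_Suc)
  have AE: "AE \<omega> in M. \<beta> (X 0 \<omega>) \<notin> S"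
  proof -
    have "AE y in bid_distr \<beta>. y \<notin> S" by (rule AE_not_in[OF S(1)])
    then have "AE \<omega> in M. bid \<beta> 0 \<omega> \<notin> S"
      unfolding bid_distr_def by (rule AE_distrD[OF bid_measurable[OF strat n_pos]])
    then show ?thesis
      by (rule AE_mp) (auto simp: bid_eq_strategy[OF n_pos])
  qed
  have meas: "{\<omega> \<in> space M. X 0 \<omega> \<le> y} \<in> events" for y
    using X_measurable[OF n_pos] by measurable
  have meas': "{\<omega> \<in> space M. \<beta> (X 0 \<omega>) \<in> A} \<in> events" if "A \<in> sets borel" for A
  proof -
    have "{\<omega> \<in> space M. bid \<beta> 0 \<omega> \<in> A} \<in> events"
      using measurable_sets[OF bid_measurable[OF strat n_pos] that] by (simp add: vimage_def Int_def conj_commute)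
    then show ?thesis by (simp add: bid_eq_strategy[OF n_pos] cong: conj_cong)
  qed
  have strict: "W (\<beta> (X 0 \<omega>)) \<noteq> W (\<beta> x)" if "\<beta> (X 0 \<omega>) \<notin> S" "\<beta> (X 0 \<omega>) \<noteq> \<beta> x" for \<omega>
    using S(2) that by blast
  have mono: "W a \<le> W c" if "a < c" for a c
    unfolding W_def by (rule D.winning_prob_mono[OF that])
  show "measure (bid_distr \<beta>) {..<\<beta> x} \<le> x powr \<alpha>"
  proof -
    have "prob {\<omega> \<in> space M. \<beta> (X 0 \<omega>) \<in> {..<\<beta> x}} \<le> prob {\<omega> \<in> space M. X 0 \<omega> \<le> x}"
    proof (rule finite_measure_mono_AE[OF _ meas])
      show "AE \<omega> in M. \<omega> \<in> {\<omega> \<in> space M. \<beta> (X 0 \<omega>) \<in> {..<\<beta> x}} \<longrightarrow> \<omega> \<in> {\<omega> \<in> space M. X 0 \<omega> \<le> x}"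
        using AE
      proof (rule AE_mp, intro AE_I2 impI)
        fix \<omega> assume \<omega>: "\<omega> \<in> space M" "\<beta> (X 0 \<omega>) \<notin> S" "\<omega> \<in> {\<omega> \<in> space M. \<beta> (X 0 \<omega>) \<in> {..<\<beta> x}}"
        have "\<not> x < X 0 \<omega>"
          using W_mono[OF x X_range[OF n_pos \<omega>(1)]] mono[of "\<beta> (X 0 \<omega>)" "\<beta> x"] strict[OF \<omega>(2)] \<omega>(3) by force
        with \<omega>(1) show "\<omega> \<in> {\<omega> \<in> space M. X 0 \<omega> \<le> x}" by simp
      qed
    qed
    then show ?thesis by (simp add: measure_bid_distr[OF strat] prob_X_le_0[OF x])
  qed
  have below: "y powr \<alpha> \<le> cdf (bid_distr \<beta>) (\<beta> x)" if y: "y \<in> {0..<x}" for y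
  proof -
    have "prob {\<omega> \<in> space M. X 0 \<omega> \<le> y} \<le> prob {\<omega> \<in> space M. \<beta> (X 0 \<omega>) \<in> {..\<beta> x}}"
    proof (rule finite_measure_mono_AE[OF _ meas'])
      show "AE \<omega> in M. \<omega> \<in> {\<omega> \<in> space M. X 0 \<omega> \<le> y} \<longrightarrow> \<omega> \<in> {\<omega> \<in> space M. \<beta> (X 0 \<omega>) \<in> {..\<beta> x}}"
        using AE
      proof (rule AE_mp, intro AE_I2 impI)
        fix \<omega> assume \<omega>: "\<omega> \<in> space M" "\<beta> (X 0 \<omega>) \<notin> S" "\<omega> \<in> {\<omega> \<in> space M. X 0 \<omega> \<le> y}"
        have "\<not> \<beta> x < \<beta> (X 0 \<omega>)"
          using W_mono[OF X_range[OF n_pos \<omega>(1)] x] mono[of "\<beta> x" "\<beta> (X 0 \<omega>)"] strict[OF \<omega>(2)] \<omega>(3) y by force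
        with \<omega>(1) show "\<omega> \<in> {\<omega> \<in> space M. \<beta> (X 0 \<omega>) \<in> {..\<beta> x}}" by simp
      qed
    qed simp
    then show ?thesis using x y by (simp add: cdf_def measure_bid_distr[OF strat] prob_X_le_0)
  qed
  show "x powr \<alpha> \<le> cdf (bid_distr \<beta>) (\<beta> x)"
  proof (cases "x = 0")
    case False
    have "((\<lambda>y. y powr \<alpha>) \<longlongrightarrow> x powr \<alpha>) (at_left x)"
      by (intro tendsto_intros) (use False in auto)
    then show ?thesis
      by (rule tendsto_upperbound[OF _ eventually_at_leftI[of 0 x]]) (use below x False in auto)
  qed (simp add: D.cdf_nonneg)
qed

lemma symmetric_equilibrium_imp_linear:
  assumes eq: "symmetric_equilibrium M X n k \<beta>" and x: "x \<in> {0..<1}"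
  shows "\<beta> x = bid_factor (n - 2) (k - 2) (1 / \<alpha>) * x"
proof -
  have strat: "bidding_strategy \<beta>" using eq by (simp add: symmetric_equilibrium_def)
  interpret D: real_distribution "bid_distr \<beta>" by (rule real_distribution_bid[OF strat])
  have \<beta>_nonneg: "0 \<le> \<beta> x" if "x \<in> {0..1}" for x
    using strat that by (simp add: bidding_strategy_def)
  have range: "w powr (1 / \<alpha>) \<in> {0..1}" if "0 \<le> w" "w \<le> 1" for w
    using that \<alpha> powr_mono2[of "1 / \<alpha>" w 1] by simp
  have nk: "n - 2 + 2 = n" "k - 2 + 2 = k" using k by auto
  interpret symmetric_bids "bid_distr \<beta>" "n - 2" "k - 2" "1 / \<alpha>" "\<lambda>w. \<beta> (w powr (1 / \<alpha>))"
  proof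
    show "0 < n - 2" "k - 2 \<le> n - 2" "0 < 1 / \<alpha>" using k \<alpha> by auto
    fix w :: real assume w: "0 \<le> w" "w \<le> 1"
    note r = range[OF w]
    show nn: "0 \<le> \<beta> (w powr (1 / \<alpha>))" by (rule \<beta>_nonneg[OF r])
    have "(w powr (1 / \<alpha>)) powr \<alpha> = w" using w \<alpha> by (simp add: powr_powr)
    then show "measure (bid_distr \<beta>) {..<\<beta> (w powr (1 / \<alpha>))} \<le> w \<and> w \<le> cdf (bid_distr \<beta>) (\<beta> (w powr (1 / \<alpha>)))"
      using equilibrium_quantile[OF eq r] by simp
    fix a :: real assume a: "0 \<le> a"
    have "expected_payoff M X n k \<beta> 0 (w powr (1 / \<alpha>)) a
      \<le> expected_payoff M X n k \<beta> 0 (w powr (1 / \<alpha>)) (\<beta> (w powr (1 / \<alpha>)))"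
      using eq r n_pos a by (auto simp: symmetric_equilibrium_def)
    then show "interval_mean (virtual_payoff (cdf (bid_distr \<beta>)) a (n - 2 + 2) (k - 2 + 2) (w powr (1 / \<alpha>)))
        (measure (bid_distr \<beta>) {..<a}) (cdf (bid_distr \<beta>) a)
      \<le> interval_mean (virtual_payoff (cdf (bid_distr \<beta>)) (\<beta> (w powr (1 / \<alpha>))) (n - 2 + 2) (k - 2 + 2) (w powr (1 / \<alpha>)))
        (measure (bid_distr \<beta>) {..<\<beta> (w powr (1 / \<alpha>))}) (cdf (bid_distr \<beta>) (\<beta> (w powr (1 / \<alpha>))))"
      unfolding nk expected_payoff_eq[OF strat n_pos a] expected_payoff_eq[OF strat n_pos nn] .
  qed
  have "x powr \<alpha> < 1" using x \<alpha> powr_less_mono2[of \<alpha> x 1] by simp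
  moreover have "(x powr \<alpha>) powr (1 / \<alpha>) = x" using x \<alpha> by (simp add: powr_powr)
  ultimately show ?thesis using bid_eq[of "x powr \<alpha>"] by simp
qed

text \<open>The slope \<open>c\<close> makes the conditional price at quantile \<open>w\<close>
  equal to \<open>w powr (1 / \<alpha>)\<close>. The marginal payoff of type \<open>x\<close> then
  has the sign of \<open>x - w powr (1 / \<alpha>)\<close>, which changes only at
  \<open>w = x powr \<alpha>\<close>, the quantile of the prescribed bid.\<close>

lemma linear_strategy_equilibrium:
  defines "c \<equiv> bid_factor (n - 2) (k - 2) (1 / \<alpha>)"
  shows "symmetric_equilibrium M X n k (\<lambda>x. c * x)"
proof -
  let ?\<beta> = "\<lambda>x. c * x" and ?s = "1 / \<alpha>"
  define D where "D = bid_distr ?\<beta>"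
  have s: "0 < ?s" and jN: "k - 2 \<le> n - 2" using k \<alpha> by auto
  have c: "0 < c" unfolding c_def by (rule bid_factor_pos[OF jN s])
  have strat: "bidding_strategy ?\<beta>"
    using c by (auto simp: bidding_strategy_def intro!: measurable_restrict_space1)
  interpret D: real_distribution D unfolding D_def by (rule real_distribution_bid[OF strat])
  note G = monoI[of "cdf D", OF D.cdf_nondecreasing] D.cdf_nonneg
  have cdf: "cdf D z = (z / c) powr \<alpha>" if "z \<in> {0..c}" for z
  proof -
    have "{\<omega> \<in> space M. c * X 0 \<omega> \<in> {..z}} = {\<omega> \<in> space M. X 0 \<omega> \<le> z / c}"
      using c by (auto simp: field_simps)
    then show ?thesis
      using that c by (simp add: D_def cdf_def measure_bid_distr[OF strat] prob_X_le_0)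
  qed
  then have top: "cdf D c = 1" using c by simp
  have no_atom: "measure D {..<a} = cdf D a" if a: "0 \<le> a" for a
  proof -
    consider "a = 0" | "0 < a" "a \<le> c" | "c < a" using a by linarith
    then show ?thesis
    proof cases
      case 1
      then show ?thesis using cdf[of 0] c D.lessThan_le_cdf[of 0] by (simp add: measure_le_0_iff)
    next
      case 2
      have "((\<lambda>z. (z / c) powr \<alpha>) \<longlongrightarrow> (a / c) powr \<alpha>) (at_left a)"
        by (intro tendsto_intros) (use 2 c in auto)
      moreover have "\<forall>\<^sub>F z in at_left a. (z / c) powr \<alpha> = cdf D z"
        by (rule eventually_at_leftI[of 0 a]) (use 2 in \<open>auto simp: cdf\<close>)
      ultimately have "(cdf D \<longlongrightarrow> (a / c) powr \<alpha>) (at_left a)"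
        by (rule Lim_transform_eventually)
      from tendsto_unique[OF _ D.cdf_at_left this] show ?thesis using 2 by (simp add: cdf)
    next
      case 3
      have "1 \<le> measure D {..<a}" using D.cdf_le_lessThan[OF 3] top by simp
      then show ?thesis using D.lessThan_le_cdf[of a] D.cdf_bounded_prob[of a] by linarith
    qed
  qed
  have powr_less: "t powr \<alpha> < w \<longleftrightarrow> t < w powr ?s" if "0 \<le> t" "0 \<le> w" for t w :: real
  proof -
    have "(t powr \<alpha>) powr ?s = t" "(w powr ?s) powr \<alpha> = w" using that \<alpha> by (simp_all add: powr_powr)
    then show ?thesis
      using powr_less_mono2[OF s, of "t powr \<alpha>" w] powr_less_mono2[OF \<alpha>, of t "w powr ?s"] that by auto
  qed
  have base: "tail_price (cdf D) c 0 0 w = c * w powr ?s" if w: "0 \<le> w" "w \<le> 1" for w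
  proof -
    have "w powr ?s \<le> 1" using powr_mono2[of ?s w 1] w s by simp
    then have le: "c * w powr ?s \<le> c" using c by simp
    have "tail_price (cdf D) c 0 0 w = integral {0..c} (\<lambda>z. of_bool (z < c * w powr ?s))"
      unfolding tail_price_def
    proof (rule integral_cong)
      fix z assume z: "z \<in> {0..c}"
      then have "cdf D z < w \<longleftrightarrow> z < c * w powr ?s"
        using c w powr_less[of "z / c" w] by (simp add: cdf field_simps)
      then show "(if cdf D z < w then binomial_tail 0 0 w (cdf D z) else 0) = of_bool (z < c * w powr ?s)" by simp
    qed
    also have "\<dots> = c * w powr ?s" using c le by (intro integral_less_eq) auto
    finally show ?thesis .
  qed
  have price: "tail_price (cdf D) c (n - 2) (k - 2) w = w powr ?s * w ^ (n - 2)" if w: "0 \<le> w" "w \<le> 1" for w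
  proof -
    have "c * tail_price (cdf D) c (n - 2) (k - 2) w = c * w powr (real (n - 2) + ?s)"
      unfolding c_def by (rule tail_price_upward[OF G s jN base[unfolded c_def] w])
    then have "tail_price (cdf D) c (n - 2) (k - 2) w = w powr (real (n - 2) + ?s)" using c by simp
    then show ?thesis using w s by (cases "w = 0") (auto simp: powr_add powr_realpow)
  qed
  define u where "u x w = x * w ^ Suc (n - 2) - tail_price (cdf D) c (Suc (n - 2)) (Suc (k - 2)) w" for x w
  have nk: "n - 1 = Suc (n - 2)" "k - 1 = Suc (k - 2)" using k by auto
  have payoff: "expected_payoff M X n k ?\<beta> i x a = u x (cdf D a)" if i: "i < n" and a: "0 \<le> a" for i x a
  proof -
    \<comment> \<open>The payoff formula is cut off at the bid \<open>a\<close>, but bids are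
      compared with the common cut-off \<open>c\<close>. Both capture the whole price:
      \<open>a\<close> reaches the quantile \<open>cdf D a\<close>, and \<open>c\<close> reaches the
      quantile \<open>1\<close>.\<close>
    have "tail_price (cdf D) a (n - 1) (k - 1) (cdf D a) = tail_price (cdf D) c (n - 1) (k - 1) (cdf D a)"
    proof (cases "a \<le> c")
      case True
      then show ?thesis by (intro tail_price_cong_bound[OF G]) (use a in auto)
    next
      case False
      then show ?thesis
        by (intro tail_price_cong_bound[OF G, symmetric]) (use c top D.cdf_bounded_prob in auto)
    qed
    then show ?thesis
      unfolding expected_payoff_eq[OF strat i a, folded D_def] no_atom[OF a] u_def nk[symmetric]
      by (simp add: virtual_payoff_def)
  qed
  \<comment> \<open>Every bid has a quantile in \<open>{0..1}\<close>, bids above \<open>c\<close>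
    having quantile \<open>1\<close>, so this covers all deviations.\<close>
  have best: "u x w \<le> u x (x powr \<alpha>)" if x: "x \<in> {0..1}" and w: "0 \<le> w" "w \<le> 1" for x w
  proof -
    have x': "(x powr \<alpha>) powr ?s = x" "0 \<le> x powr \<alpha>" "x powr \<alpha> \<le> 1"
      using x \<alpha> powr_mono2[of \<alpha> x 1] by (simp_all add: powr_powr)
    show ?thesis
    proof (cases "w \<le> x powr \<alpha>")
      case True
      have "tail_price (cdf D) c (Suc (n - 2)) (Suc (k - 2)) (x powr \<alpha>) - tail_price (cdf D) c (Suc (n - 2)) (Suc (k - 2)) w
        \<le> x * ((x powr \<alpha>) ^ Suc (n - 2) - w ^ Suc (n - 2))"
      proof (rule tail_price_diff_le[OF G w(1) True])
        fix v assume v: "w < v" "v < x powr \<alpha>"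
        then have "v powr ?s \<le> x" using powr_mono2[of ?s v "x powr \<alpha>"] x' w s by simp
        then show "tail_price (cdf D) c (n - 2) (k - 2) v \<le> x * v ^ (n - 2)"
          using price[of v] v w x' by (simp add: mult_right_mono)
      qed
      then show ?thesis by (simp add: u_def right_diff_distrib del: power_Suc)
    next
      case False
      then have le: "x powr \<alpha> \<le> w" by simp
      have "x * (w ^ Suc (n - 2) - (x powr \<alpha>) ^ Suc (n - 2))
        \<le> tail_price (cdf D) c (Suc (n - 2)) (Suc (k - 2)) w - tail_price (cdf D) c (Suc (n - 2)) (Suc (k - 2)) (x powr \<alpha>)"
      proof (rule tail_price_diff_ge[OF G x'(2) le])
        fix v assume v: "x powr \<alpha> < v" "v < w"
        then have "x \<le> v powr ?s" using powr_mono2[of ?s "x powr \<alpha>" v] x' w s by simp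
        moreover have v0: "0 \<le> v" using v(1) x'(2) by linarith
        ultimately show "x * v ^ (n - 2) \<le> tail_price (cdf D) c (n - 2) (k - 2) v"
          using price[of v] v w by (simp add: mult_right_mono)
      qed
      then show ?thesis by (simp add: u_def right_diff_distrib del: power_Suc)
    qed
  qed
  show ?thesis
    unfolding symmetric_equilibrium_def
  proof (intro conjI strat allI ballI impI)
    fix i x a assume i: "i < n" and x: "x \<in> {0..1::real}" and a: "0 \<le> (a :: real)"
    have "cdf D (c * x) = x powr \<alpha>" using cdf[of "c * x"] x c by simp
    then show "expected_payoff M X n k ?\<beta> i x a \<le> expected_payoff M X n k ?\<beta> i x (c * x)"
      using best[OF x D.cdf_nonneg D.cdf_bounded_prob, of a] payoff[OF i a] payoff[OF i, of "c * x"] x c by simp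
  qed
qed

end

section \<open>Closed forms of the slope\<close>

text \<open>The functional equation of Gamma telescopes the product. Raising \<open>N\<close> and
  \<open>j\<close> together keeps \<open>N - j\<close> fixed, so only the two values at the upper
  end change.\<close>

lemma bid_factor_eq_Gamma:
  assumes "j \<le> N" "0 < s"
  shows "bid_factor N j s
    = Gamma (real (N - j) + 1) * Gamma (real N + 1 + s) / (Gamma (real N + 1) * Gamma (real (N - j) + 1 + s))"
  using assms(1)
proof (induction j arbitrary: N)
  case 0
  have "Gamma (real N + 1) \<noteq> 0" "Gamma (real N + 1 + s) \<noteq> 0"
    using Gamma_real_pos[of "real N + 1"] Gamma_real_pos[of "real N + 1 + s"] assms(2)
    by (simp_all add: less_imp_neq[symmetric] add_nonneg_pos)
  then show ?case by (simp add: bid_factor_def)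
next
  case (Suc j)
  then obtain N' where N: "N = Suc N'" and le: "j \<le> N'" by (cases N) auto
  have "Gamma (x + 1) = x * Gamma x" if "0 < x" for x :: real
    using that by (intro Gamma_plus1) (auto dest: nonpos_Ints_nonpos)
  from this[of "real N' + 1"] this[of "real N' + 1 + s"]
  have "Gamma (real (Suc N') + 1) = real (Suc N') * Gamma (real N' + 1)"
    "Gamma (real (Suc N') + 1 + s) = (real (Suc N') + s) * Gamma (real N' + 1 + s)"
    using assms(2) by (simp_all add: add_ac add_pos_nonneg)
  then show ?case
    unfolding N bid_factor_Suc Suc.IH[OF le] by (simp add: mult_ac)
qed

text \<open>Raising \<open>N\<close> and \<open>j\<close> together keeps the lower limits of both
  products fixed and adds one top factor to each.\<close>

lemma bid_factor_eq_prod: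
  assumes "j \<le> N"
  shows "bid_factor N j (real m) = (\<Prod>i=N - j + m + 1..N + m. real i) / (\<Prod>i=N - j + 1..N. real i)"
  using assms
proof (induction j arbitrary: N)
  case 0
  then show ?case by (simp add: bid_factor_def)
next
  case (Suc j)
  then obtain N' where N: "N = Suc N'" and le: "j \<le> N'" by (cases N) auto
  have "(\<Prod>i=N' - j + m + 1..Suc (N' + m). real i) = real (Suc (N' + m)) * (\<Prod>i=N' - j + m + 1..N' + m. real i)"
    "(\<Prod>i=N' - j + 1..Suc N'. real i) = real (Suc N') * (\<Prod>i=N' - j + 1..N'. real i)"
    by (rule prod.nat_ivl_Suc'; simp)+
  then show ?case
    by (simp add: N bid_factor_Suc Suc.IH[OF le])
qed

theorem theorem5p2:
  fixes M :: "'w measure" and X :: "nat \<Rightarrow> 'w \<Rightarrow> real" and n k :: nat and \<alpha> :: real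
  assumes "k \<ge> 2" and "n > k" and "\<alpha> > 0"
    and "prob_space M"
    and "prob_space.indep_vars M (\<lambda>_. borel) X {..<n}"
    and "\<forall>i<n. \<forall>\<omega>\<in>space M. X i \<omega> \<in> {0..1}"
    and "\<forall>i<n. \<forall>x\<in>{0..1}. cdf (distr M borel (X i)) x = x powr \<alpha>"
  shows "\<exists>\<beta>. symmetric_equilibrium M X n k \<beta> \<and>
    (\<forall>\<beta>'. symmetric_equilibrium M X n k \<beta>' \<longrightarrow> (\<forall>x\<in>{0..<1}. \<beta>' x = \<beta> x)) \<and>
    (\<forall>x\<in>{0..1}. \<beta> x =
       Gamma (real n - real k + 1) * Gamma (real n - 1 + 1 / \<alpha>) /
       (Gamma (real n - 1) * Gamma (real n - real k + 1 + 1 / \<alpha>)) * x) \<and>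
    (\<forall>m::nat. m > 0 \<and> \<alpha> = 1 / real m \<longrightarrow>
       (\<forall>x\<in>{0..1}. \<beta> x =
          (\<Prod>i = n - k + m + 1..n - 2 + m. real i) / (\<Prod>i = n - k + 1..n - 2. real i) * x))"
proof -
  interpret power_law_auction M X n k \<alpha>
    using assms by (auto simp: power_law_auction_def power_law_auction_axioms_def)
  let ?c = "bid_factor (n - 2) (k - 2) (1 / \<alpha>)"
  have le: "k - 2 \<le> n - 2" and d: "n - 2 - (k - 2) = n - k" using assms by auto
  have r: "real (n - k) = real n - real k" "real (n - 2) + 1 = real n - 1" using assms by auto
  have Gamma: "?c = Gamma (real n - real k + 1) * Gamma (real n - 1 + 1 / \<alpha>) /
    (Gamma (real n - 1) * Gamma (real n - real k + 1 + 1 / \<alpha>))"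
    using bid_factor_eq_Gamma[OF le, of "1 / \<alpha>"] assms(3) unfolding d r by simp
  have "?c = (\<Prod>i = n - k + m + 1..n - 2 + m. real i) / (\<Prod>i = n - k + 1..n - 2. real i)"
    if "\<alpha> = 1 / real m" for m
    using bid_factor_eq_prod[OF le, of m] that unfolding d by simp
  then show ?thesis
    using linear_strategy_equilibrium symmetric_equilibrium_imp_linear
    by (intro exI[of _ "\<lambda>x. ?c * x"]) (simp add: Gamma[symmetric])
qed

end
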